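(* Let $\mathfrak D$ be a triangulated category endowed with a bounded, nondegenerate $t$-structure $(\mathfrak D^{\le 0},\mathfrak D^{\ge 0})$ and a bounded, nondegenerate baric structure $(\{\mathfrak D_{\le w}\},\{\mathfrak D_{\ge w}\})_{w\in\mathbb Z}$ that are compatible. Suppose we have a function $\mu$ assigning to each object of $\mathfrak D$ an element of $\mathbb N=\{0,1,2,\dots\}$ with the following properties: (1) $\mu(X)=0$ if and only if $X=0$. (2) If $X\in\mathfrak D^{\ge n}$ but $X\notin\mathfrak D^{\ge n+1}$, then $\mu(\tau^{\ge n+1}\beta_{\le -n}X)<\mu(X)$. Then $({}^s\mathfrak D^{\le 0},{}^s\mathfrak D^{\ge 0})$ is a bounded, nondegenerate $t$-structure on $\mathfrak D$, where $${}^s\mathfrak D^{\le 0}=\{A\in\mathfrak D\mid h^k(A)\in\mathfrak D_{\le -k}\text{ for all }k\in\mathbb Z\},\qquad {}^s\mathfrak D^{\ge 0}=\{B\in\mathfrak D\mid\beta_{\le k}B\in\mathfrak D^{\ge -k}\text{ for all }k\in\mathbb Z\}.$$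
   Context: A baric structure on a triangulated category $\mathfrak D$ is a pair of collections of thick subcategories $(\{\mathfrak D_{\le w}\},\{\mathfrak D_{\ge w}\})_{w\in\mathbb Z}$ such that: (1) $\mathfrak D_{\le w}\subset\mathfrak D_{\le w+1}$ and $\mathfrak D_{\ge w}\supset\mathfrak D_{\ge w+1}$ for all $w$; (2) $\mathrm{Hom}(A,B)=0$ whenever $A\in\mathfrak D_{\le w}$ and $B\in\mathfrak D_{\ge w+1}$; (3) for any object $X$ and any $w$ there is a distinguished triangle $A\to X\to B\to$ with $A\in\mathfrak D_{\le w}$, $B\in\mathfrak D_{\ge w+1}$. The inclusion $\mathfrak D_{\le w}\hookrightarrow\mathfrak D$ has a right adjoint $\beta_{\le w}$ and $\mathfrak D_{\ge w}\hookrightarrow\mathfrak D$ has a left adjoint $\beta_{\ge w}$ (baric truncation functors), and the triangle in (3) is canonically $\beta_{\le w}X\to X\to\beta_{\ge w+1}X\to$. The baric structure is bounded if every object lies in $\mathfrak D_{\ge v}\cap\mathfrak D_{\le w}$ for some $v,w$, and nondegenerate if no nonzero object belongs to all $\mathfrak D_{\le w}$ or to all $\mathfrak D_{\ge w}$. For a $t$-structure, $\tau^{\le n},\tau^{\ge n}$ are its truncation functors and $h^n$ its cohomology functors (with values in the heart). It is bounded if every object lies in $\mathfrak D^{\ge m}\cap\mathfrak D^{\le n}$ for some $m,n$, and nondegenerate if no nonzero object belongs to all $\mathfrak D^{\le n}$ or to all $\mathfrak D^{\ge n}$. The $t$-structure and the baric structure are compatible if $\tau^{\le n}$ and $\tau^{\ge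 n}$ map $\mathfrak D_{\le w}$ into $\mathfrak D_{\le w}$ and $\beta_{\le w}$, $\beta_{\ge w}$ map $\mathfrak D^{\ge n}$ into $\mathfrak D^{\ge n}$, for all $n,w$. *)

theory Defs
  imports "HOL-Algebra.Group"
begin

record ('o, 'm) category =
  Ob :: "'o set"
  Ar :: "'m set"
  Src :: "'m \<Rightarrow> 'o"
  Tgt :: "'m \<Rightarrow> 'o"
  Ident :: "'o \<Rightarrow> 'm"
  Cmp :: "'m \<Rightarrow> 'm \<Rightarrow> 'm"  (infixl "\<odot>\<index>" 70)

definition Hom :: "('o, 'm, 'z) category_scheme \<Rightarrow> 'o \<Rightarrow> 'o \<Rightarrow> 'm set" where
  "Hom C X Y = {f \<in> Ar C. Src C f = X \<and> Tgt C f = Y}"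

text \<open>Composition is written in the usual order: \<open>g \<odot> f\<close> is \<open>g\<close> after \<open>f\<close>.\<close>

locale category =
  fixes C :: "('o, 'm, 'z) category_scheme" (structure)
  assumes Src_in: "f \<in> Ar C \<Longrightarrow> Src C f \<in> Ob C"
    and Tgt_in: "f \<in> Ar C \<Longrightarrow> Tgt C f \<in> Ob C"
    and Ident_in: "X \<in> Ob C \<Longrightarrow> Ident C X \<in> Hom C X X"
    and Cmp_in: "f \<in> Hom C X Y \<Longrightarrow> g \<in> Hom C Y Z \<Longrightarrow> g \<odot> f \<in> Hom C X Z"
    and Cmp_assoc: "f \<in> Hom C W X \<Longrightarrow> g \<in> Hom C X Y \<Longrightarrow> h \<in> Hom C Y Z
      \<Longrightarrow> (h \<odot> g) \<odot> f = h \<odot> (g \<odot> f)"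
    and Ident_right: "f \<in> Hom C X Y \<Longrightarrow> f \<odot> Ident C X = f"
    and Ident_left: "f \<in> Hom C X Y \<Longrightarrow> Ident C Y \<odot> f = f"

definition iso_arrow :: "('o, 'm, 'z) category_scheme \<Rightarrow> 'm \<Rightarrow> 'o \<Rightarrow> 'o \<Rightarrow> bool" where
  "iso_arrow C f X Y \<longleftrightarrow> f \<in> Hom C X Y \<and>
    (\<exists>g \<in> Hom C Y X. g \<odot>\<^bsub>C\<^esub> f = Ident C X \<and> f \<odot>\<^bsub>C\<^esub> g = Ident C Y)"

definition zero_object :: "('o, 'm, 'z) category_scheme \<Rightarrow> 'o \<Rightarrow> bool" where
  "zero_object C Z \<longleftrightarrow> Z \<in> Ob C \<and>
    (\<forall>X \<in> Ob C. (\<exists>!f. f \<in> Hom C X Z) \<and> (\<exists>!f. f \<in> Hom C Z X))"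

record ('o, 'm, 'p, 'n) cat_functor =
  fob :: "'o \<Rightarrow> 'p"
  far :: "'m \<Rightarrow> 'n"

definition is_functor ::
  "('o, 'm, 'y) category_scheme \<Rightarrow> ('p, 'n, 'z) category_scheme \<Rightarrow> ('o, 'm, 'p, 'n) cat_functor \<Rightarrow> bool"
where
  "is_functor C D F \<longleftrightarrow>
    (\<forall>X \<in> Ob C. fob F X \<in> Ob D) \<and>
    (\<forall>X Y. \<forall>f \<in> Hom C X Y. far F f \<in> Hom D (fob F X) (fob F Y)) \<and>
    (\<forall>X \<in> Ob C. far F (Ident C X) = Ident D (fob F X)) \<and>
    (\<forall>X Y Z. \<forall>f \<in> Hom C X Y. \<forall>g \<in> Hom C Y Z.
        far F (g \<odot>\<^bsub>C\<^esub> f) = far F g \<odot>\<^bsub>D\<^esub> far F f)"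

text \<open>\<open>adjunction C D F G\<close>: the functor \<open>F : C \<rightarrow> D\<close> is left adjoint to \<open>G : D \<rightarrow> C\<close>.\<close>

definition adjunction ::
  "('o, 'm, 'y) category_scheme \<Rightarrow> ('p, 'n, 'z) category_scheme \<Rightarrow>
   ('o, 'm, 'p, 'n) cat_functor \<Rightarrow> ('p, 'n, 'o, 'm) cat_functor \<Rightarrow> bool"
where
  "adjunction C D F G \<longleftrightarrow> is_functor C D F \<and> is_functor D C G \<and>
    (\<exists>\<phi>.
      (\<forall>A \<in> Ob C. \<forall>X \<in> Ob D. bij_betw (\<phi> A X) (Hom D (fob F A) X) (Hom C A (fob G X))) \<and>
      (\<forall>A \<in> Ob C. \<forall>A' \<in> Ob C. \<forall>X \<in> Ob D. \<forall>X' \<in> Ob D.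
        \<forall>a \<in> Hom C A' A. \<forall>x \<in> Hom D X X'. \<forall>f \<in> Hom D (fob F A) X.
          \<phi> A' X' (x \<odot>\<^bsub>D\<^esub> f \<odot>\<^bsub>D\<^esub> far F a) = far G x \<odot>\<^bsub>C\<^esub> \<phi> A X f \<odot>\<^bsub>C\<^esub> a))"

text \<open>Full subcategories are given by their sets of objects.\<close>

definition full_sub :: "('o, 'm, 'z) category_scheme \<Rightarrow> 'o set \<Rightarrow> ('o, 'm) category" where
  "full_sub C S = \<lparr>Ob = Ob C \<inter> S, Ar = {f \<in> Ar C. Src C f \<in> S \<and> Tgt C f \<in> S},
    Src = Src C, Tgt = Tgt C, Ident = Ident C, Cmp = Cmp C\<rparr>"

definition inclusion :: "('o, 'm, 'o, 'm) cat_functor" where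
  "inclusion = \<lparr>fob = (\<lambda>X. X), far = (\<lambda>f. f)\<rparr>"

definition strictly_full :: "('o, 'm, 'z) category_scheme \<Rightarrow> 'o set \<Rightarrow> bool" where
  "strictly_full C S \<longleftrightarrow> S \<subseteq> Ob C \<and> (\<forall>X \<in> S. \<forall>Y f. iso_arrow C f X Y \<longrightarrow> Y \<in> S)"

record ('o, 'm) add_category = "('o, 'm) category" +
  Hplus :: "'m \<Rightarrow> 'm \<Rightarrow> 'm"  (infixl "\<boxplus>\<index>" 65)
  Hzero :: "'o \<Rightarrow> 'o \<Rightarrow> 'm"

definition hom_group :: "('o, 'm, 'z) add_category_scheme \<Rightarrow> 'o \<Rightarrow> 'o \<Rightarrow> 'm monoid" where
  "hom_group C X Y = \<lparr>carrier = Hom C X Y, mult = Hplus C, one = Hzero C X Y\<rparr>"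

definition Hminus :: "('o, 'm, 'z) add_category_scheme \<Rightarrow> 'm \<Rightarrow> 'm" where
  "Hminus C f = inv\<^bsub>hom_group C (Src C f) (Tgt C f)\<^esub> f"

definition is_biproduct ::
  "('o, 'm, 'z) add_category_scheme \<Rightarrow> 'o \<Rightarrow> 'o \<Rightarrow> 'o \<Rightarrow> 'm \<Rightarrow> 'm \<Rightarrow> 'm \<Rightarrow> 'm \<Rightarrow> bool"
where
  "is_biproduct C W X Y i j p q \<longleftrightarrow>
    i \<in> Hom C X W \<and> j \<in> Hom C Y W \<and> p \<in> Hom C W X \<and> q \<in> Hom C W Y \<and>
    p \<odot>\<^bsub>C\<^esub> i = Ident C X \<and> q \<odot>\<^bsub>C\<^esub> j = Ident C Y \<and>
    q \<odot>\<^bsub>C\<^esub> i = Hzero C X Y \<and> p \<odot>\<^bsub>C\<^esub> j = Hzero C Y X \<and>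
    (i \<odot>\<^bsub>C\<^esub> p) \<boxplus>\<^bsub>C\<^esub> (j \<odot>\<^bsub>C\<^esub> q) = Ident C W"

locale additive_category = category C
  for C :: "('o, 'm, 'z) add_category_scheme" (structure) +
  assumes hom_comm_group: "X \<in> Ob C \<Longrightarrow> Y \<in> Ob C \<Longrightarrow> comm_group (hom_group C X Y)"
    and Cmp_plus_right: "f \<in> Hom C X Y \<Longrightarrow> f' \<in> Hom C X Y \<Longrightarrow> g \<in> Hom C Y Z
      \<Longrightarrow> g \<odot> (f \<boxplus> f') = (g \<odot> f) \<boxplus> (g \<odot> f')"
    and Cmp_plus_left: "f \<in> Hom C X Y \<Longrightarrow> g \<in> Hom C Y Z \<Longrightarrow> g' \<in> Hom C Y Z
      \<Longrightarrow> (g \<boxplus> g') \<odot> f = (g \<odot> f) \<boxplus> (g' \<odot> f)"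
    and zero_object_exists: "\<exists>Z. zero_object C Z"
    and biproduct_exists: "X \<in> Ob C \<Longrightarrow> Y \<in> Ob C \<Longrightarrow> \<exists>W i j p q. is_biproduct C W X Y i j p q"

text \<open>
  As in Verdier's definition, the translation \<open>X \<mapsto> X[1]\<close> is an automorphism of the category;
  it is recorded together with all its integral powers, \<open>Shift n\<close> being \<open>X \<mapsto> X[n]\<close>.
  A triangle is recorded by its three arrows.
\<close>

record ('o, 'm) tri_category = "('o, 'm) add_category" +
  Shift :: "int \<Rightarrow> ('o, 'm, 'o, 'm) cat_functor"
  Dist :: "('m \<times> 'm \<times> 'm) set"

abbreviation shO :: "('o, 'm, 'z) tri_category_scheme \<Rightarrow> int \<Rightarrow> 'o \<Rightarrow> 'o" where
  "shO D n \<equiv> fob (Shift D n)"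

abbreviation shA :: "('o, 'm, 'z) tri_category_scheme \<Rightarrow> int \<Rightarrow> 'm \<Rightarrow> 'm" where
  "shA D n \<equiv> far (Shift D n)"

definition triangle ::
  "('o, 'm, 'z) tri_category_scheme \<Rightarrow> 'o \<Rightarrow> 'o \<Rightarrow> 'o \<Rightarrow> 'm \<Rightarrow> 'm \<Rightarrow> 'm \<Rightarrow> bool"
where
  "triangle D X Y Z f g h \<longleftrightarrow> f \<in> Hom D X Y \<and> g \<in> Hom D Y Z \<and> h \<in> Hom D Z (shO D 1 X)"

definition dist_triangle ::
  "('o, 'm, 'z) tri_category_scheme \<Rightarrow> 'o \<Rightarrow> 'o \<Rightarrow> 'o \<Rightarrow> 'm \<Rightarrow> 'm \<Rightarrow> 'm \<Rightarrow> bool"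
where
  "dist_triangle D X Y Z f g h \<longleftrightarrow> triangle D X Y Z f g h \<and> (f, g, h) \<in> Dist D"

locale triangulated_category = additive_category D
  for D :: "('o, 'm, 'z) tri_category_scheme" (structure) +
  assumes Shift_functor: "is_functor D D (Shift D n)"
    and Shift_additive: "f \<in> Hom D X Y \<Longrightarrow> f' \<in> Hom D X Y
      \<Longrightarrow> shA D n (f \<boxplus> f') = shA D n f \<boxplus> shA D n f'"
    and Shift_0_ob: "X \<in> Ob D \<Longrightarrow> shO D 0 X = X"
    and Shift_0_ar: "f \<in> Ar D \<Longrightarrow> shA D 0 f = f"
    and Shift_add_ob: "X \<in> Ob D \<Longrightarrow> shO D (m + n) X = shO D m (shO D n X)"
    and Shift_add_ar: "f \<in> Ar D \<Longrightarrow> shA D (m + n) f = shA D m (shA D n f)"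
    and Dist_triangle: "(f, g, h) \<in> Dist D \<Longrightarrow> \<exists>X Y Z. triangle D X Y Z f g h"
    and TR1_iso: "dist_triangle D X Y Z f g h \<Longrightarrow> triangle D X' Y' Z' f' g' h'
      \<Longrightarrow> iso_arrow D a X X' \<Longrightarrow> iso_arrow D b Y Y' \<Longrightarrow> iso_arrow D c Z Z'
      \<Longrightarrow> b \<odot> f = f' \<odot> a \<Longrightarrow> c \<odot> g = g' \<odot> b \<Longrightarrow> shA D 1 a \<odot> h = h' \<odot> c
      \<Longrightarrow> dist_triangle D X' Y' Z' f' g' h'"
    and TR1_ident: "X \<in> Ob D \<Longrightarrow> zero_object D Z
      \<Longrightarrow> dist_triangle D X X Z (Ident D X) (Hzero D X Z) (Hzero D Z (shO D 1 X))"
    and TR1_cone: "f \<in> Hom D X Y \<Longrightarrow> \<exists>Z g h. dist_triangle D X Y Z f g h"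
    and TR2: "triangle D X Y Z f g h \<Longrightarrow>
      dist_triangle D X Y Z f g h \<longleftrightarrow>
      dist_triangle D Y Z (shO D 1 X) g h (Hminus D (shA D 1 f))"
    and TR3: "dist_triangle D X Y Z f g h \<Longrightarrow> dist_triangle D X' Y' Z' f' g' h'
      \<Longrightarrow> a \<in> Hom D X X' \<Longrightarrow> b \<in> Hom D Y Y' \<Longrightarrow> b \<odot> f = f' \<odot> a
      \<Longrightarrow> \<exists>c \<in> Hom D Z Z'. c \<odot> g = g' \<odot> b \<and> shA D 1 a \<odot> h = h' \<odot> c"
    and TR4: "dist_triangle D X Y Z' f a a' \<Longrightarrow> dist_triangle D Y Z X' g c c'
      \<Longrightarrow> dist_triangle D X Z Y' (g \<odot> f) b b'
      \<Longrightarrow> \<exists>u v. dist_triangle D Z' Y' X' u v (shA D 1 a \<odot> c') \<and>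
            u \<odot> a = b \<odot> g \<and> b' \<odot> u = a' \<and> v \<odot> b = c \<and> c' \<odot> v = shA D 1 f \<odot> b'"

text \<open>
  Closure under cones and under all shifts (negative ones included) gives, by rotation, that two
  objects of a distinguished triangle lying in \<open>S\<close> force the third to lie in \<open>S\<close>.
\<close>

definition thick :: "('o, 'm, 'z) tri_category_scheme \<Rightarrow> 'o set \<Rightarrow> bool" where
  "thick D S \<longleftrightarrow> strictly_full D S \<and>
    (\<forall>Z. zero_object D Z \<longrightarrow> Z \<in> S) \<and>
    (\<forall>X \<in> S. \<forall>n. shO D n X \<in> S) \<and>
    (\<forall>X Y Z f g h. dist_triangle D X Y Z f g h \<longrightarrow> X \<in> S \<longrightarrow> Y \<in> S \<longrightarrow> Z \<in> S) \<and>
    (\<forall>W X Y i j p q. is_biproduct D W X Y i j p q \<longrightarrow> W \<in> S \<longrightarrow> X \<in> S)"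

definition Hom_vanishes :: "('o, 'm, 'z) add_category_scheme \<Rightarrow> 'o set \<Rightarrow> 'o set \<Rightarrow> bool" where
  "Hom_vanishes D S T \<longleftrightarrow> (\<forall>A \<in> S. \<forall>B \<in> T. Hom D A B = {Hzero D A B})"

definition decomposes :: "('o, 'm, 'z) tri_category_scheme \<Rightarrow> 'o set \<Rightarrow> 'o set \<Rightarrow> bool" where
  "decomposes D S T \<longleftrightarrow>
    (\<forall>X \<in> Ob D. \<exists>A \<in> S. \<exists>B \<in> T. \<exists>f g h. dist_triangle D A X B f g h)"

text \<open>
  The next three notions are used for families of full subcategories indexed by the integers, both
  \<open>(\<DD>\<^sup>\<le>\<^sup>n, \<DD>\<^sup>\<ge>\<^sup>n)\<close> of a t-structure and \<open>(\<DD>\<^sub>\<le>\<^sub>w, \<DD>\<^sub>\<ge>\<^sub>w)\<close> of a baric structure.  In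
  \<open>truncations\<close>, \<open>l n\<close> is right adjoint to the inclusion of \<open>L n\<close> and \<open>g n\<close> is left adjoint to the
  inclusion of \<open>G n\<close>; adjoints being unique only up to isomorphism, they are taken as data.
\<close>

definition bounded_family ::
  "('o, 'm, 'z) category_scheme \<Rightarrow> (int \<Rightarrow> 'o set) \<Rightarrow> (int \<Rightarrow> 'o set) \<Rightarrow> bool"
where
  "bounded_family D L G \<longleftrightarrow> (\<forall>X \<in> Ob D. \<exists>m n. X \<in> G m \<inter> L n)"

definition nondegenerate_family ::
  "('o, 'm, 'z) category_scheme \<Rightarrow> (int \<Rightarrow> 'o set) \<Rightarrow> (int \<Rightarrow> 'o set) \<Rightarrow> bool"
where
  "nondegenerate_family D L G \<longleftrightarrow>
    (\<forall>X \<in> Ob D. ((\<forall>n. X \<in> L n) \<longrightarrow> zero_object D X) \<and> ((\<forall>n. X \<in> G n) \<longrightarrow> zero_object D X))"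

definition truncations ::
  "('o, 'm, 'z) category_scheme \<Rightarrow> (int \<Rightarrow> 'o set) \<Rightarrow> (int \<Rightarrow> 'o set) \<Rightarrow>
   (int \<Rightarrow> ('o, 'm, 'o, 'm) cat_functor) \<Rightarrow> (int \<Rightarrow> ('o, 'm, 'o, 'm) cat_functor) \<Rightarrow> bool"
where
  "truncations D L G l g \<longleftrightarrow>
    (\<forall>n. adjunction (full_sub D (L n)) D inclusion (l n) \<and>
         adjunction D (full_sub D (G n)) (g n) inclusion)"

text \<open>
  For \<open>S\<close> equal to \<open>\<DD>\<^sup>\<le>\<^sup>0\<close> or \<open>\<DD>\<^sup>\<ge>\<^sup>0\<close>, \<open>tpart D S n\<close> is \<open>S[-n]\<close>, that is \<open>\<DD>\<^sup>\<le>\<^sup>n\<close> or \<open>\<DD>\<^sup>\<ge>\<^sup>n\<close>.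
\<close>

definition tpart :: "('o, 'm, 'z) tri_category_scheme \<Rightarrow> 'o set \<Rightarrow> int \<Rightarrow> 'o set" where
  "tpart D S n = shO D (- n) ` S"

definition t_structure :: "('o, 'm, 'z) tri_category_scheme \<Rightarrow> 'o set \<Rightarrow> 'o set \<Rightarrow> bool" where
  "t_structure D Tle Tge \<longleftrightarrow>
    strictly_full D Tle \<and> strictly_full D Tge \<and>
    Tle \<subseteq> tpart D Tle 1 \<and> tpart D Tge 1 \<subseteq> Tge \<and>
    Hom_vanishes D Tle (tpart D Tge 1) \<and>
    decomposes D Tle (tpart D Tge 1)"

definition t_bounded :: "('o, 'm, 'z) tri_category_scheme \<Rightarrow> 'o set \<Rightarrow> 'o set \<Rightarrow> bool" where
  "t_bounded D Tle Tge \<longleftrightarrow> bounded_family D (tpart D Tle) (tpart D Tge)"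

definition t_nondegenerate :: "('o, 'm, 'z) tri_category_scheme \<Rightarrow> 'o set \<Rightarrow> 'o set \<Rightarrow> bool" where
  "t_nondegenerate D Tle Tge \<longleftrightarrow> nondegenerate_family D (tpart D Tle) (tpart D Tge)"

definition baric_structure ::
  "('o, 'm, 'z) tri_category_scheme \<Rightarrow> (int \<Rightarrow> 'o set) \<Rightarrow> (int \<Rightarrow> 'o set) \<Rightarrow> bool"
where
  "baric_structure D Ble Bge \<longleftrightarrow>
    (\<forall>w. thick D (Ble w) \<and> thick D (Bge w) \<and>
      Ble w \<subseteq> Ble (w + 1) \<and> Bge (w + 1) \<subseteq> Bge w \<and>
      Hom_vanishes D (Ble w) (Bge (w + 1)) \<and>
      decomposes D (Ble w) (Bge (w + 1)))"

text \<open>\<open>h\<^sup>k X = \<tau>\<^sup>\<ge>\<^sup>0 \<tau>\<^sup>\<le>\<^sup>0 (X[k])\<close>, an object of the heart.\<close>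

definition cohomology ::
  "('o, 'm, 'z) tri_category_scheme \<Rightarrow>
   (int \<Rightarrow> ('o, 'm, 'o, 'm) cat_functor) \<Rightarrow> (int \<Rightarrow> ('o, 'm, 'o, 'm) cat_functor) \<Rightarrow>
   int \<Rightarrow> 'o \<Rightarrow> 'o"
where
  "cohomology D tle tge k X = fob (tge 0) (fob (tle 0) (shO D k X))"

definition compatible ::
  "('o, 'm, 'z) tri_category_scheme \<Rightarrow> 'o set \<Rightarrow>
   (int \<Rightarrow> ('o, 'm, 'o, 'm) cat_functor) \<Rightarrow> (int \<Rightarrow> ('o, 'm, 'o, 'm) cat_functor) \<Rightarrow>
   (int \<Rightarrow> 'o set) \<Rightarrow>
   (int \<Rightarrow> ('o, 'm, 'o, 'm) cat_functor) \<Rightarrow> (int \<Rightarrow> ('o, 'm, 'o, 'm) cat_functor) \<Rightarrow> bool"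
where
  "compatible D Tge tle tge Ble ble bge \<longleftrightarrow>
    (\<forall>n w.
      (\<forall>X \<in> Ble w. fob (tle n) X \<in> Ble w \<and> fob (tge n) X \<in> Ble w) \<and>
      (\<forall>X \<in> tpart D Tge n. fob (ble w) X \<in> tpart D Tge n \<and> fob (bge w) X \<in> tpart D Tge n))"

definition staggered_le ::
  "('o, 'm, 'z) tri_category_scheme \<Rightarrow>
   (int \<Rightarrow> ('o, 'm, 'o, 'm) cat_functor) \<Rightarrow> (int \<Rightarrow> ('o, 'm, 'o, 'm) cat_functor) \<Rightarrow>
   (int \<Rightarrow> 'o set) \<Rightarrow> 'o set"
where
  "staggered_le D tle tge Ble = {A \<in> Ob D. \<forall>k. cohomology D tle tge k A \<in> Ble (- k)}"

definition staggered_ge ::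
  "('o, 'm, 'z) tri_category_scheme \<Rightarrow> 'o set \<Rightarrow> (int \<Rightarrow> ('o, 'm, 'o, 'm) cat_functor) \<Rightarrow> 'o set"
where
  "staggered_ge D Tge ble = {B \<in> Ob D. \<forall>k. fob (ble k) B \<in> tpart D Tge (- k)}"

end

theory Submission
  imports Defs
begin

text \<open>
  Call an object of \<open>\<DD>\<^sub>\<le>\<^sub>k \<inter> \<DD>\<^sup>\<le>\<^sup>-\<^sup>k\<close>, for some \<open>k\<close>, a generator, and an object of
  \<open>\<DD>\<^sub>\<ge>\<^sub>1\<^sub>-\<^sub>k \<inter> \<DD>\<^sup>\<ge>\<^sup>k\<close>, for some \<open>k\<close>, a cogenerator.  There is no nonzero arrow from a generator of
  index \<open>j\<close> to a cogenerator of index \<open>k\<close>: if \<open>- j < k\<close> this is the orthogonality of the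
  t-structure, and otherwise \<open>j < 1 - k\<close> and it is the orthogonality of the baric structure.

  Compatibility of the two structures turns the two staggered classes into orthogonals:
  \<open>\<^sup>s\<DD>\<^sup>\<le>\<^sup>0\<close> consists of the objects without nonzero arrows to cogenerators, and \<open>\<^sup>s\<DD>\<^sup>\<ge>\<^sup>1\<close> of the
  objects without nonzero arrows from generators (\<open>staggered_le_eq\<close>, \<open>staggered_ge_1\<close>).  In this
  form both classes are visibly closed under isomorphism and extension, the first under \<open>[1]\<close> and
  the second under \<open>[- 1]\<close>, and they contain the generators and the cogenerators, respectively.

  Orthogonality of the staggered classes (\<open>left_orth_perp_right_orth\<close>) is a devissage.  If \<open>A\<close> in
  \<open>\<^sup>s\<DD>\<^sup>\<le>\<^sup>0\<close> lies in \<open>\<DD>\<^sup>\<ge>\<^sup>n\<close>, then its baric truncation \<open>\<beta>\<^sub>\<ge>\<^sub>1\<^sub>-\<^sub>n A\<close> is a cogenerator, so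
  \<open>A \<rightarrow> \<beta>\<^sub>\<ge>\<^sub>1\<^sub>-\<^sub>n A\<close> vanishes and \<open>A\<close> lies in \<open>\<DD>\<^sub>\<le>\<^sub>-\<^sub>n\<close>.  Then \<open>\<tau>\<^sup>\<le>\<^sup>n A\<close> is a generator, and removing it
  shortens \<open>A\<close>.  So \<open>A\<close> is a finite extension of generators.

  The decomposition of a nonzero object \<open>X\<close> (\<open>staggered_decomposition\<close>) goes by induction on \<open>\<mu> X\<close>.  Let
  \<open>n\<close> be the largest integer with \<open>X\<close> in \<open>\<DD>\<^sup>\<ge>\<^sup>n\<close>, and write \<open>Y = \<beta>\<^sub>\<le>\<^sub>-\<^sub>n X\<close>.  In the triangles
  \<open>Y \<rightarrow> X \<rightarrow> \<beta>\<^sub>\<ge>\<^sub>1\<^sub>-\<^sub>n X\<close> and \<open>\<tau>\<^sup>\<le>\<^sup>n Y \<rightarrow> Y \<rightarrow> \<tau>\<^sup>\<ge>\<^sup>n\<^sup>+\<^sup>1 Y\<close> the third term of the first is a cogenerator, the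
  first term of the second is a generator, and \<open>\<tau>\<^sup>\<ge>\<^sup>n\<^sup>+\<^sup>1 Y\<close> can be decomposed by induction.  Two
  octahedra assemble the parts.

  Finally, a high enough shift of any object is a generator and a low enough one a cogenerator,
  which gives boundedness; and a bounded t-structure is nondegenerate because an object that is
  orthogonal to itself is zero.

  Distinguished triangles mostly enter through their objects only (\<open>tri\<close>).  This loses nothing
  for extension arguments, where \<open>Hom\<close> into or out of two of the objects vanishes, and the
  octahedral axiom has an object-level form as well.
\<close>

section \<open>Categories and additive categories\<close>

context category
begin

lemma Hom_objects:
  assumes "f \<in> Hom C X Y"
  shows "X \<in> Ob C" "Y \<in> Ob C"
  using assms Src_in Tgt_in by (auto simp: Hom_def)

lemma iso_arrow_objects:
  assumes "iso_arrow C f X Y"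
  shows "X \<in> Ob C" "Y \<in> Ob C"
  using assms Hom_objects[of f X Y] by (auto simp: iso_arrow_def)

lemma iso_arrow_Ident: "X \<in> Ob C \<Longrightarrow> iso_arrow C (Ident C X) X X"
  unfolding iso_arrow_def using Ident_in Ident_left by blast

lemma iso_arrow_inverse:
  assumes "iso_arrow C f X Y"
  obtains g where "g \<in> Hom C Y X" "g \<odot> f = Ident C X" "f \<odot> g = Ident C Y" "iso_arrow C g Y X"
  using assms unfolding iso_arrow_def by blast

lemma zero_object_unique:
  assumes "zero_object C Z"
  shows "f \<in> Hom C X Z \<Longrightarrow> g \<in> Hom C X Z \<Longrightarrow> f = g"
    and "f \<in> Hom C Z X \<Longrightarrow> g \<in> Hom C Z X \<Longrightarrow> f = g"
  using assms Hom_objects[of f] unfolding zero_object_def by blast+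

end

context additive_category
begin

lemma Hzero_in: "X \<in> Ob C \<Longrightarrow> Y \<in> Ob C \<Longrightarrow> Hzero C X Y \<in> Hom C X Y"
  using monoid.one_closed[OF group.is_monoid, OF comm_group.axioms(2)[OF hom_comm_group]]
  by (simp add: hom_group_def)

lemma Hplus_idem:
  assumes "f \<in> Hom C X Y" "f \<boxplus> f = f"
  shows "f = Hzero C X Y"
proof -
  interpret G: comm_group "hom_group C X Y"
    using assms(1) Hom_objects hom_comm_group by blast
  show ?thesis using G.l_cancel_one[of f f] assms by (simp add: hom_group_def)
qed

lemma Hzero_plus:
  assumes "f \<in> Hom C X Y"
  shows "Hzero C X Y \<boxplus> f = f"
proof -
  interpret G: comm_group "hom_group C X Y"
    using assms(1) Hom_objects hom_comm_group by blast
  show ?thesis using G.l_one[of f] assms by (simp add: hom_group_def)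
qed

lemma Hplus_in:
  assumes "f \<in> Hom C X Y" "g \<in> Hom C X Y"
  shows "f \<boxplus> g \<in> Hom C X Y"
proof -
  interpret G: comm_group "hom_group C X Y"
    using assms(1) Hom_objects hom_comm_group by blast
  show ?thesis using G.m_closed[of f g] assms by (simp add: hom_group_def)
qed

lemma Cmp_zero_right:
  assumes "g \<in> Hom C Y Z" "X \<in> Ob C"
  shows "g \<odot> Hzero C X Y = Hzero C X Z"
proof -
  have z: "Hzero C X Y \<in> Hom C X Y" using assms Hom_objects Hzero_in by blast
  show ?thesis
    using Hplus_idem[OF Cmp_in[OF z assms(1)]] Cmp_plus_right[OF z z assms(1)] Hzero_plus[OF z]
    by simp
qed

lemma Cmp_zero_left:
  assumes "f \<in> Hom C X Y" "Z \<in> Ob C"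
  shows "Hzero C Y Z \<odot> f = Hzero C X Z"
proof -
  have z: "Hzero C Y Z \<in> Hom C Y Z" using assms Hom_objects Hzero_in by blast
  show ?thesis
    using Hplus_idem[OF Cmp_in[OF assms(1) z]] Cmp_plus_left[OF assms(1) z z] Hzero_plus[OF z]
    by simp
qed

lemma Hminus_eqI:
  assumes "f \<in> Hom C X Y" "g \<in> Hom C X Y" "g \<boxplus> f = Hzero C X Y"
  shows "Hminus C f = g"
proof -
  interpret G: comm_group "hom_group C X Y"
    using assms(1) Hom_objects hom_comm_group by blast
  have "Src C f = X" "Tgt C f = Y" using assms(1) by (auto simp: Hom_def)
  then show ?thesis using G.inv_equality[of g f] assms by (simp add: Hminus_def hom_group_def)
qed

lemma
  assumes "f \<in> Hom C X Y"
  shows Hminus_in: "Hminus C f \<in> Hom C X Y"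
    and Hminus_plus: "Hminus C f \<boxplus> f = Hzero C X Y"
    and plus_Hminus: "f \<boxplus> Hminus C f = Hzero C X Y"
proof -
  interpret G: comm_group "hom_group C X Y"
    using assms(1) Hom_objects hom_comm_group by blast
  have st: "Src C f = X" "Tgt C f = Y" using assms(1) by (auto simp: Hom_def)
  show "Hminus C f \<in> Hom C X Y" "Hminus C f \<boxplus> f = Hzero C X Y"
    "f \<boxplus> Hminus C f = Hzero C X Y"
    using G.inv_closed[of f] G.l_inv[of f] G.r_inv[of f] assms
    by (simp_all add: Hminus_def hom_group_def st)
qed

lemma Hminus_Hminus: "f \<in> Hom C X Y \<Longrightarrow> Hminus C (Hminus C f) = f"
  by (rule Hminus_eqI[OF Hminus_in _ plus_Hminus])

lemma Cmp_Hminus_left: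
  assumes "f \<in> Hom C X Y" "g \<in> Hom C Y Z"
  shows "Hminus C g \<odot> f = Hminus C (g \<odot> f)"
proof (rule Hminus_eqI[symmetric])
  show "g \<odot> f \<in> Hom C X Z" "Hminus C g \<odot> f \<in> Hom C X Z"
    using assms Cmp_in Hminus_in by blast+
  show "(Hminus C g \<odot> f) \<boxplus> (g \<odot> f) = Hzero C X Z"
    using Cmp_plus_left[OF assms(1) Hminus_in[OF assms(2)] assms(2)] Hminus_plus[OF assms(2)]
      Cmp_zero_left[OF assms(1) Hom_objects(2)[OF assms(2)]] by simp
qed

lemma Cmp_Hminus_right:
  assumes "f \<in> Hom C X Y" "g \<in> Hom C Y Z"
  shows "g \<odot> Hminus C f = Hminus C (g \<odot> f)"
proof (rule Hminus_eqI[symmetric])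
  show "g \<odot> f \<in> Hom C X Z" "g \<odot> Hminus C f \<in> Hom C X Z"
    using assms Cmp_in Hminus_in by blast+
  show "(g \<odot> Hminus C f) \<boxplus> (g \<odot> f) = Hzero C X Z"
    using Cmp_plus_right[OF Hminus_in[OF assms(1)] assms(1) assms(2)] Hminus_plus[OF assms(1)]
      Cmp_zero_right[OF assms(2) Hom_objects(1)[OF assms(1)]] by simp
qed

text \<open>
  The equation makes both \<open>A\<close> and \<open>B\<close> objects, since \<open>Hzero C A B\<close> is then an arrow between them.
\<close>

definition perp :: "'o \<Rightarrow> 'o \<Rightarrow> bool" where
  "perp A B \<longleftrightarrow> Hom C A B = {Hzero C A B}"

lemma perpI:
  assumes "A \<in> Ob C" "B \<in> Ob C" "\<And>f. f \<in> Hom C A B \<Longrightarrow> f = Hzero C A B"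
  shows "perp A B"
  using assms Hzero_in unfolding perp_def by blast

lemma perpD: "perp A B \<Longrightarrow> f \<in> Hom C A B \<Longrightarrow> f = Hzero C A B"
  unfolding perp_def by blast

lemma perp_objects:
  assumes "perp A B"
  shows "A \<in> Ob C" "B \<in> Ob C"
  using assms Hom_objects[of "Hzero C A B" A B] unfolding perp_def by auto

lemma perp_zero_object:
  assumes "zero_object C Z" "X \<in> Ob C"
  shows "perp Z X" "perp X Z"
proof -
  have "Z \<in> Ob C" using assms(1) by (simp add: zero_object_def)
  then show "perp Z X" "perp X Z"
    using zero_object_unique[OF assms(1)] Hzero_in assms(2) by (auto intro!: perpI)
qed

lemma zero_object_if_perp_self:
  assumes "perp X X"
  shows "zero_object C X"
proof -
  have X: "X \<in> Ob C" and id: "Ident C X = Hzero C X X"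
    using assms perp_objects perpD Ident_in by blast+
  have "f = Hzero C Y X" if "f \<in> Hom C Y X" for f Y
    using Ident_left[OF that] Cmp_zero_left[OF that X] id by simp
  moreover have "f = Hzero C X Y" if "f \<in> Hom C X Y" for f Y
    using Ident_right[OF that] Cmp_zero_right[OF that X] id by simp
  ultimately show ?thesis unfolding zero_object_def using X Hzero_in by blast
qed

end

section \<open>Triangles and the exactness of Hom\<close>

context triangulated_category
begin

lemma shO_in: "X \<in> Ob D \<Longrightarrow> shO D n X \<in> Ob D"
  using Shift_functor unfolding is_functor_def by blast

lemma shA_in: "f \<in> Hom D X Y \<Longrightarrow> shA D n f \<in> Hom D (shO D n X) (shO D n Y)"
  using Shift_functor unfolding is_functor_def by blast

lemma shA_Cmp:
  "f \<in> Hom D X Y \<Longrightarrow> g \<in> Hom D Y Z \<Longrightarrow> shA D n (g \<odot> f) = shA D n g \<odot> shA D n f"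
  using Shift_functor[of n] unfolding is_functor_def by blast

lemma shA_Ident: "X \<in> Ob D \<Longrightarrow> shA D n (Ident D X) = Ident D (shO D n X)"
  using Shift_functor[of n] unfolding is_functor_def by blast

lemma shO_shO: "X \<in> Ob D \<Longrightarrow> shO D m (shO D n X) = shO D (m + n) X"
  by (simp add: Shift_add_ob)

lemma shO_inverse:
  assumes "X \<in> Ob D"
  shows "shO D n (shO D (- n) X) = X" "shO D (- n) (shO D n X) = X"
  using assms by (simp_all add: shO_shO Shift_0_ob)

lemma shA_inverse:
  assumes "f \<in> Hom D X Y"
  shows "shA D n (shA D (- n) f) = f" "shA D (- n) (shA D n f) = f"
proof -
  have "f \<in> Ar D" using assms by (simp add: Hom_def)
  then show "shA D n (shA D (- n) f) = f" "shA D (- n) (shA D n f) = f"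
    using Shift_add_ar[of f n "- n"] Shift_add_ar[of f "- n" n] Shift_0_ar by simp_all
qed

lemma shA_zero:
  assumes "X \<in> Ob D" "Y \<in> Ob D"
  shows "shA D n (Hzero D X Y) = Hzero D (shO D n X) (shO D n Y)"
proof (rule Hplus_idem)
  note z = Hzero_in[OF assms]
  show "shA D n (Hzero D X Y) \<in> Hom D (shO D n X) (shO D n Y)" by (rule shA_in[OF z])
  show "shA D n (Hzero D X Y) \<boxplus> shA D n (Hzero D X Y) = shA D n (Hzero D X Y)"
    using Shift_additive[OF z z, of n] Hzero_plus[OF z] by simp
qed

lemma shA_Hminus:
  assumes "f \<in> Hom D X Y"
  shows "shA D n (Hminus D f) = Hminus D (shA D n f)"
  using Hminus_eqI[OF shA_in[OF assms] shA_in[OF Hminus_in[OF assms]]]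
    Shift_additive[OF Hminus_in[OF assms] assms] Hminus_plus[OF assms]
    shA_zero[OF Hom_objects[OF assms]] by simp

lemma perp_shift:
  assumes "A \<in> Ob D" "B \<in> Ob D"
  shows "perp (shO D n A) B \<longleftrightarrow> perp A (shO D (- n) B)"
proof
  assume *: "perp (shO D n A) B"
  show "perp A (shO D (- n) B)"
  proof (rule perpI)
    fix f assume f: "f \<in> Hom D A (shO D (- n) B)"
    have "shA D n f = Hzero D (shO D n A) B"
      using perpD[OF *] shA_in[OF f, of n] shO_inverse[OF assms(2)] by simp
    then show "f = Hzero D A (shO D (- n) B)"
      using shA_inverse(2)[OF f, of n] shA_zero[of "shO D n A" B "- n"] assms
      by (simp add: shO_in shO_inverse)
  qed (use assms shO_in in auto)
next
  assume *: "perp A (shO D (- n) B)"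
  show "perp (shO D n A) B"
  proof (rule perpI)
    fix f assume f: "f \<in> Hom D (shO D n A) B"
    have "shA D (- n) f = Hzero D A (shO D (- n) B)"
      using perpD[OF *] shA_in[OF f, of "- n"] shO_inverse[OF assms(1)] by simp
    then show "f = Hzero D (shO D n A) B"
      using shA_inverse(1)[OF f, of n] shA_zero[of A "shO D (- n) B" n] assms
      by (simp add: shO_in shO_inverse)
  qed (use assms shO_in in auto)
qed

lemma zero_object_shift:
  assumes "zero_object D Z"
  shows "zero_object D (shO D n Z)"
proof -
  have Z: "Z \<in> Ob D" using assms by (simp add: zero_object_def)
  then have "perp (shO D n Z) (shO D n Z)"
    using perp_zero_object[OF assms] by (simp add: perp_shift shO_in)
  then show ?thesis by (rule zero_object_if_perp_self)
qed

text \<open>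
  Signs and arrows disappear at the level of objects, so that \<open>tri\<close> is preserved by rotation in
  both directions and by all shifts.
\<close>

definition tri :: "'o \<Rightarrow> 'o \<Rightarrow> 'o \<Rightarrow> bool" where
  "tri X Y Z \<longleftrightarrow> (\<exists>f g h. dist_triangle D X Y Z f g h)"

lemma dist_triangle_arrows:
  assumes "dist_triangle D X Y Z f g h"
  shows "f \<in> Hom D X Y" "g \<in> Hom D Y Z" "h \<in> Hom D Z (shO D 1 X)"
  using assms by (auto simp: dist_triangle_def triangle_def)

lemma tri_objects:
  assumes "tri X Y Z"
  shows "X \<in> Ob D" "Y \<in> Ob D" "Z \<in> Ob D"
proof -
  obtain f g h where T: "dist_triangle D X Y Z f g h" using assms by (auto simp: tri_def)
  show "X \<in> Ob D" "Y \<in> Ob D" "Z \<in> Ob D"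
    using Hom_objects[OF dist_triangle_arrows(1)[OF T]]
      Hom_objects[OF dist_triangle_arrows(2)[OF T]] by simp_all
qed

lemma dist_triangle_objects:
  assumes "dist_triangle D X Y Z f g h"
  shows "X \<in> Ob D" "Y \<in> Ob D" "Z \<in> Ob D"
  using tri_objects[of X Y Z] assms unfolding tri_def by blast+

lemma dist_triangle_rotate:
  "dist_triangle D X Y Z f g h
    \<Longrightarrow> dist_triangle D Y Z (shO D 1 X) g h (Hminus D (shA D 1 f))"
  using TR2[of X Y Z f g h] unfolding dist_triangle_def by blast

lemma tri_rotate: "tri X Y Z \<Longrightarrow> tri Y Z (shO D 1 X)"
  unfolding tri_def using dist_triangle_rotate by blast

lemma dist_triangle_rotate_back:
  assumes T: "dist_triangle D X Y Z f g h"
  obtains k where "dist_triangle D (shO D (- 1) Z) X Y k f g"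
proof -
  note a = dist_triangle_arrows[OF T]
  have Z: "Z \<in> Ob D" and X: "X \<in> Ob D" using dist_triangle_objects[OF T] by blast+
  define k where "k = Hminus D (shA D (- 1) h)"
  have h': "shA D (- 1) h \<in> Hom D (shO D (- 1) Z) X"
    using shA_in[OF a(3), of "- 1"] X shO_inverse(2)[of X 1] by simp
  have k: "k \<in> Hom D (shO D (- 1) Z) X" unfolding k_def by (rule Hminus_in[OF h'])
  have "Hminus D (shA D 1 k) = shA D 1 (shA D (- 1) h)"
    using shA_Hminus[OF h', of 1] Hminus_Hminus[OF shA_in[OF h', of 1]] by (simp add: k_def)
  also have "\<dots> = h" using shA_inverse[OF a(3), of 1] by simp
  finally have hk: "Hminus D (shA D 1 k) = h" .
  have Z1: "shO D 1 (shO D (- 1) Z) = Z" using shO_inverse[OF Z, of 1] by simp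
  have "triangle D (shO D (- 1) Z) X Y k f g"
    using k a Z1 by (simp add: triangle_def)
  then have "dist_triangle D (shO D (- 1) Z) X Y k f g"
    using TR2 T hk Z1 by simp
  then show ?thesis by (rule that)
qed

lemma tri_rotate_back: "tri X Y Z \<Longrightarrow> tri (shO D (- 1) Z) X Y"
  unfolding tri_def using dist_triangle_rotate_back by blast

text \<open>
  Three rotations shift a triangle by \<open>1\<close>, up to the sign of its arrows.
\<close>

lemma tri_shift:
  assumes "tri X Y Z"
  shows "tri (shO D n X) (shO D n Y) (shO D n Z)"
proof (induction n rule: int_induct[where k = 0])
  case base
  show ?case using assms by (simp add: Shift_0_ob tri_objects[OF assms])
next
  case (step1 i)
  from tri_rotate[OF tri_rotate[OF tri_rotate[OF step1(2)]]]
  show ?case using tri_objects[OF assms] by (simp add: shO_shO add.commute)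
next
  case (step2 i)
  from tri_rotate_back[OF tri_rotate_back[OF tri_rotate_back[OF step2(2)]]]
  show ?case using tri_objects[OF assms] by (simp add: shO_shO)
qed

text \<open>
  Whatever arrows realise the two given triangles, the third triangle of the octahedron can be
  taken on their composite.
\<close>

lemma tri_octahedron:
  assumes "tri X Y Z'" "tri Y Z X'"
  obtains Y' where "tri X Z Y'" "tri Z' Y' X'"
proof -
  obtain f a a' where 1: "dist_triangle D X Y Z' f a a'" using assms(1) by (auto simp: tri_def)
  obtain g c c' where 2: "dist_triangle D Y Z X' g c c'" using assms(2) by (auto simp: tri_def)
  have "g \<odot> f \<in> Hom D X Z" by (rule Cmp_in[OF dist_triangle_arrows(1)[OF 1] dist_triangle_arrows(1)[OF 2]])
  then obtain Y' b b' where 3: "dist_triangle D X Z Y' (g \<odot> f) b b'" using TR1_cone by blast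
  show ?thesis using TR4[OF 1 2 3] 3 that unfolding tri_def by blast
qed

lemma tri_zero_right: "X \<in> Ob D \<Longrightarrow> zero_object D Z \<Longrightarrow> tri X X Z"
  unfolding tri_def using TR1_ident by blast

lemma dist_triangle_zero_left:
  assumes W: "W \<in> Ob D" and N: "zero_object D N"
  shows "dist_triangle D N W W (Hzero D N W) (Ident D W) (Hzero D W (shO D 1 N))"
proof -
  have No: "N \<in> Ob D" using N by (simp add: zero_object_def)
  note sh = zero_object_shift[OF N, of 1]
  have m: "Hminus D (shA D 1 (Hzero D N W)) = Hzero D (shO D 1 N) (shO D 1 W)"
    by (rule zero_object_unique(2)[OF sh Hminus_in[OF shA_in[OF Hzero_in[OF No W]]]
        Hzero_in[OF shO_in[OF No] shO_in[OF W]]])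
  have "triangle D N W W (Hzero D N W) (Ident D W) (Hzero D W (shO D 1 N))"
    using Hzero_in Ident_in shO_in No W by (simp add: triangle_def)
  then show ?thesis using TR2 TR1_ident[OF W sh] m by simp
qed

text \<open>
  An arrow killed by \<open>f\<close> extends to a morphism of triangles into \<open>0 \<rightarrow> W \<rightarrow> W\<close>, whose third component
  is the factorisation.
\<close>

lemma weak_cokernel:
  assumes T: "dist_triangle D X Y Z f g h"
    and x: "x \<in> Hom D Y W" and "x \<odot> f = Hzero D X W"
  obtains y where "y \<in> Hom D Z W" "x = y \<odot> g"
proof -
  obtain N where N: "zero_object D N" using zero_object_exists by blast
  then have No: "N \<in> Ob D" by (simp add: zero_object_def)
  have X: "X \<in> Ob D" and W: "W \<in> Ob D"
    using dist_triangle_objects(1)[OF T] Hom_objects(2)[OF x] by blast+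
  have "x \<odot> f = Hzero D N W \<odot> Hzero D X N"
    using assms(3) Cmp_zero_right[OF Hzero_in[OF No W] X] by simp
  from TR3[OF T dist_triangle_zero_left[OF W N] Hzero_in[OF X No] x this]
  obtain c where "c \<in> Hom D Z W" "c \<odot> g = Ident D W \<odot> x" by blast
  then show ?thesis using that Ident_left[OF x] by metis
qed

text \<open>
  Dually, \<open>x\<close> and the zero arrow form the start of a morphism from the rotation of \<open>W \<rightarrow> W \<rightarrow> 0\<close> to
  that of the given triangle; its third component is a shift of the factorisation.
\<close>

lemma weak_kernel:
  assumes T: "dist_triangle D X Y Z f g h"
    and x: "x \<in> Hom D W Y" and "g \<odot> x = Hzero D W Z"
  obtains y where "y \<in> Hom D W X" "x = f \<odot> y"
proof -
  obtain N where N: "zero_object D N" using zero_object_exists by blast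
  then have No: "N \<in> Ob D" by (simp add: zero_object_def)
  note a = dist_triangle_arrows[OF T]
  have X: "X \<in> Ob D" and Z: "Z \<in> Ob D" and W: "W \<in> Ob D"
    using dist_triangle_objects(1,3)[OF T] Hom_objects(1)[OF x] by blast+
  have "Hzero D N Z \<odot> Hzero D W N = g \<odot> x"
    using assms(3) Cmp_zero_right[OF Hzero_in[OF No Z] W] by simp
  from TR3[OF dist_triangle_rotate[OF TR1_ident[OF W N]] dist_triangle_rotate[OF T] x
      Hzero_in[OF No Z] this]
  obtain c where c: "c \<in> Hom D (shO D 1 W) (shO D 1 X)"
    and e: "shA D 1 x \<odot> Hminus D (shA D 1 (Ident D W)) = Hminus D (shA D 1 f) \<odot> c" by blast
  define y where "y = shA D (- 1) c"
  have y: "y \<in> Hom D W X"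
    using shA_in[OF c, of "- 1"] shO_inverse[of W 1] shO_inverse[of X 1] W X by (simp add: y_def)
  have cy: "c = shA D 1 y" using shA_inverse[OF c, of 1] by (simp add: y_def)
  have "Hminus D (shA D 1 x) = shA D 1 x \<odot> Hminus D (shA D 1 (Ident D W))"
    using Cmp_Hminus_right[OF shA_in[OF Ident_in[OF W], of 1] shA_in[OF x, of 1]]
      shA_Cmp[OF Ident_in[OF W] x, of 1] Ident_right[OF x] by simp
  also have "\<dots> = Hminus D (shA D 1 (f \<odot> y))"
    using e cy Cmp_Hminus_left[OF shA_in[OF y, of 1] shA_in[OF a(1), of 1]] shA_Cmp[OF y a(1), of 1]
    by simp
  finally have "shA D 1 x = shA D 1 (f \<odot> y)"
    using Hminus_Hminus shA_in[OF x, of 1] shA_in[OF Cmp_in[OF y a(1)], of 1] by metis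
  then have "x = f \<odot> y"
    using shA_inverse(2)[OF x, of 1] shA_inverse(2)[OF Cmp_in[OF y a(1)], of 1] by metis
  then show ?thesis using that y by blast
qed

lemma perp_extension_left:
  assumes "tri X Y Z" "perp X B" "perp Z B"
  shows "perp Y B"
proof -
  obtain f g h where T: "dist_triangle D X Y Z f g h" using assms(1) by (auto simp: tri_def)
  note a = dist_triangle_arrows[OF T]
  show ?thesis
  proof (rule perpI)
    show Y: "Y \<in> Ob D" and B: "B \<in> Ob D"
      using tri_objects[OF assms(1)] perp_objects[OF assms(2)] by blast+
    fix x assume x: "x \<in> Hom D Y B"
    have "x \<odot> f = Hzero D X B" using perpD[OF assms(2)] Cmp_in[OF a(1) x] by blast
    from weak_cokernel[OF T x this] obtain y where "y \<in> Hom D Z B" "x = y \<odot> g" .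
    then show "x = Hzero D Y B" using perpD[OF assms(3)] Cmp_zero_left[OF a(2) B] by simp
  qed
qed

lemma perp_extension_right:
  assumes "tri X Y Z" "perp A X" "perp A Z"
  shows "perp A Y"
proof -
  obtain f g h where T: "dist_triangle D X Y Z f g h" using assms(1) by (auto simp: tri_def)
  note a = dist_triangle_arrows[OF T]
  show ?thesis
  proof (rule perpI)
    show Y: "Y \<in> Ob D" and A: "A \<in> Ob D"
      using tri_objects[OF assms(1)] perp_objects[OF assms(2)] by blast+
    fix x assume x: "x \<in> Hom D A Y"
    have "g \<odot> x = Hzero D A Z" using perpD[OF assms(3)] Cmp_in[OF x a(2)] by blast
    from weak_kernel[OF T x this] obtain y where "y \<in> Hom D A X" "x = f \<odot> y" .
    then show "x = Hzero D A Y" using perpD[OF assms(2)] Cmp_zero_right[OF a(1) A] by simp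
  qed
qed

lemma perp_iso_left:
  assumes "iso_arrow D i X X'" "perp X B"
  shows "perp X' B"
proof (rule perpI)
  obtain j where j: "j \<in> Hom D X' X" "i \<odot> j = Ident D X'"
    using assms(1) by (auto elim: iso_arrow_inverse)
  have i: "i \<in> Hom D X X'" using assms(1) by (simp add: iso_arrow_def)
  show "X' \<in> Ob D" and B: "B \<in> Ob D" using Hom_objects(1)[OF j(1)] perp_objects[OF assms(2)] by blast+
  fix x assume x: "x \<in> Hom D X' B"
  have "x = (x \<odot> i) \<odot> j" using Cmp_assoc[OF j(1) i x] j(2) Ident_right[OF x] by simp
  also have "x \<odot> i = Hzero D X B" using perpD[OF assms(2)] Cmp_in[OF i x] by blast
  finally show "x = Hzero D X' B" using Cmp_zero_left[OF j(1) B] by simp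
qed

lemma perp_iso_right:
  assumes "iso_arrow D i X X'" "perp A X"
  shows "perp A X'"
proof (rule perpI)
  obtain j where j: "j \<in> Hom D X' X" "i \<odot> j = Ident D X'"
    using assms(1) by (auto elim: iso_arrow_inverse)
  have i: "i \<in> Hom D X X'" using assms(1) by (simp add: iso_arrow_def)
  show "X' \<in> Ob D" and A: "A \<in> Ob D" using Hom_objects(1)[OF j(1)] perp_objects[OF assms(2)] by blast+
  fix x assume x: "x \<in> Hom D A X'"
  have "x = i \<odot> (j \<odot> x)" using Cmp_assoc[OF x j(1) i] j(2) Ident_left[OF x] by simp
  also have "j \<odot> x = Hzero D A X" using perpD[OF assms(2)] Cmp_in[OF x j(1)] by blast
  finally show "x = Hzero D A X'" using Cmp_zero_right[OF i A] by simp
qed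

text \<open>
  The middle object is fixed: this is how a truncation triangle is rewritten with the values of the
  truncation functors at its two ends.
\<close>

lemma dist_triangle_iso_ends:
  assumes T: "dist_triangle D X Y Z f g h"
    and a: "iso_arrow D a X X'" and c: "iso_arrow D c Z Z'"
  shows "tri X' Y Z'"
proof -
  note ar = dist_triangle_arrows[OF T]
  obtain a' where a': "a' \<in> Hom D X' X" "a' \<odot> a = Ident D X"
    using a by (auto elim: iso_arrow_inverse)
  obtain c' where c': "c' \<in> Hom D Z' Z" "c' \<odot> c = Ident D Z"
    using c by (auto elim: iso_arrow_inverse)
  have aH: "a \<in> Hom D X X'" and cH: "c \<in> Hom D Z Z'" using a c by (simp_all add: iso_arrow_def)
  have Y: "Y \<in> Ob D" using dist_triangle_objects[OF T] by blast
  have f': "f \<odot> a' \<in> Hom D X' Y" by (rule Cmp_in[OF a'(1) ar(1)])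
  have g': "c \<odot> g \<in> Hom D Y Z'" by (rule Cmp_in[OF ar(2) cH])
  have ah: "shA D 1 a \<odot> h \<in> Hom D Z (shO D 1 X')" by (rule Cmp_in[OF ar(3) shA_in[OF aH]])
  have h': "(shA D 1 a \<odot> h) \<odot> c' \<in> Hom D Z' (shO D 1 X')" using Cmp_in[OF c'(1) ah] .
  have "dist_triangle D X' Y Z' (f \<odot> a') (c \<odot> g) ((shA D 1 a \<odot> h) \<odot> c')"
  proof (rule TR1_iso[OF T _ a iso_arrow_Ident[OF Y] c])
    show "triangle D X' Y Z' (f \<odot> a') (c \<odot> g) ((shA D 1 a \<odot> h) \<odot> c')"
      using f' g' h' by (simp add: triangle_def)
    show "Ident D Y \<odot> f = (f \<odot> a') \<odot> a"
      using Cmp_assoc[OF aH a'(1) ar(1)] a'(2) Ident_left[OF ar(1)] Ident_right[OF ar(1)] by simp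
    show "c \<odot> g = (c \<odot> g) \<odot> Ident D Y" using Ident_right[OF g'] by simp
    show "shA D 1 a \<odot> h = ((shA D 1 a \<odot> h) \<odot> c') \<odot> c"
      using Cmp_assoc[OF cH c'(1) ah] c'(2) Ident_right[OF ah] by simp
  qed
  then show ?thesis unfolding tri_def by blast
qed

text \<open>
  The identity of \<open>Y\<close> lifts along \<open>f\<close> because \<open>g\<close> vanishes, and the identity of \<open>X\<close> extends along
  \<open>f\<close> because the arrow from \<open>Z[-1]\<close> to \<open>X\<close> vanishes; so \<open>f\<close> has inverses on both sides.
\<close>

lemma dist_triangle_zero_iso:
  assumes T: "dist_triangle D X Y Z f g h" and Z: "zero_object D Z"
  shows "iso_arrow D f X Y"
proof -
  note a = dist_triangle_arrows[OF T]
  have X: "X \<in> Ob D" and Y: "Y \<in> Ob D" using dist_triangle_objects[OF T] by blast+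
  have "g \<odot> Ident D Y = Hzero D Y Z"
    by (rule zero_object_unique(1)[OF Z Cmp_in[OF Ident_in[OF Y] a(2)]
        Hzero_in[OF Y dist_triangle_objects(3)[OF T]]])
  from weak_kernel[OF T Ident_in[OF Y] this]
  obtain r where r: "r \<in> Hom D Y X" and fr: "Ident D Y = f \<odot> r" .
  obtain k where K: "dist_triangle D (shO D (- 1) Z) X Y k f g"
    using dist_triangle_rotate_back[OF T] .
  note k = dist_triangle_arrows(1)[OF K]
  have "Ident D X \<odot> k = Hzero D (shO D (- 1) Z) X"
    by (rule zero_object_unique(2)[OF zero_object_shift[OF Z] Cmp_in[OF k Ident_in[OF X]]
        Hzero_in[OF Hom_objects(1)[OF k] X]])
  from weak_cokernel[OF K Ident_in[OF X] this]
  obtain l where l: "l \<in> Hom D Y X" and lf: "Ident D X = l \<odot> f" .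
  have "l = (l \<odot> f) \<odot> r"
    using Cmp_assoc[OF r a(1) l] fr Ident_right[OF l] by simp
  also have "\<dots> = r" using lf Ident_left[OF r] by simp
  finally show ?thesis using a(1) r fr lf unfolding iso_arrow_def by auto
qed


text \<open>
  Lifts along \<open>f\<close> are unique once no nonzero arrow from \<open>W\<close> reaches \<open>Z[-1]\<close>: the difference of two
  lifts factors through \<open>Z[-1]\<close>.
\<close>

lemma dist_triangle_cancel_left:
  assumes T: "dist_triangle D X Y Z f g h" and W: "perp W (shO D (- 1) Z)"
    and y: "y \<in> Hom D W X" "y' \<in> Hom D W X" and eq: "f \<odot> y = f \<odot> y'"
  shows "y = y'"
proof -
  note a = dist_triangle_arrows[OF T]
  obtain k where K: "dist_triangle D (shO D (- 1) Z) X Y k f g"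
    using dist_triangle_rotate_back[OF T] .
  note k = dist_triangle_arrows(1)[OF K]
  define d where "d = y \<boxplus> Hminus D y'"
  have Wo: "W \<in> Ob D" using Hom_objects[OF y(1)] by blast
  have d: "d \<in> Hom D W X"
    unfolding d_def by (rule Hplus_in[OF y(1) Hminus_in[OF y(2)]])
  have "f \<odot> d = (f \<odot> y) \<boxplus> Hminus D (f \<odot> y')"
    unfolding d_def Cmp_plus_right[OF y(1) Hminus_in[OF y(2)] a(1)]
    using Cmp_Hminus_right[OF y(2) a(1)] by simp
  also have "\<dots> = Hzero D W Y" unfolding eq by (rule plus_Hminus[OF Cmp_in[OF y(2) a(1)]])
  finally obtain z where z: "z \<in> Hom D W (shO D (- 1) Z)" "d = k \<odot> z"
    using weak_kernel[OF K d] by blast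
  then have "d = Hzero D W X" using perpD[OF W] Cmp_zero_right[OF k Wo] by simp
  then have "Hminus D (Hminus D y') = y"
    using Hminus_eqI[OF Hminus_in[OF y(2)] y(1)] by (simp add: d_def)
  then show ?thesis using Hminus_Hminus[OF y(2)] by simp
qed

lemma dist_triangle_cancel_right:
  assumes T: "dist_triangle D X Y Z f g h" and W: "perp (shO D 1 X) W"
    and y: "y \<in> Hom D Z W" "y' \<in> Hom D Z W" and eq: "y \<odot> g = y' \<odot> g"
  shows "y = y'"
proof -
  note a = dist_triangle_arrows[OF T]
  define d where "d = y \<boxplus> Hminus D y'"
  have Wo: "W \<in> Ob D" using Hom_objects[OF y(1)] by blast
  have d: "d \<in> Hom D Z W"
    unfolding d_def by (rule Hplus_in[OF y(1) Hminus_in[OF y(2)]])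
  have "d \<odot> g = (y \<odot> g) \<boxplus> Hminus D (y' \<odot> g)"
    unfolding d_def Cmp_plus_left[OF a(2) y(1) Hminus_in[OF y(2)]]
    using Cmp_Hminus_left[OF a(2) y(2)] by simp
  also have "\<dots> = Hzero D Y W" unfolding eq by (rule plus_Hminus[OF Cmp_in[OF a(2) y(2)]])
  finally obtain z where z: "z \<in> Hom D (shO D 1 X) W" "d = z \<odot> h"
    using weak_cokernel[OF dist_triangle_rotate[OF T] d] by blast
  then have "d = Hzero D Z W" using perpD[OF W] Cmp_zero_left[OF a(3) Wo] by simp
  then have "Hminus D (Hminus D y') = y"
    using Hminus_eqI[OF Hminus_in[OF y(2)] y(1)] by (simp add: d_def)
  then show ?thesis using Hminus_Hminus[OF y(2)] by simp
qed

lemma perp_shift_shift: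
  assumes "A \<in> Ob D" "B \<in> Ob D"
  shows "perp (shO D n A) (shO D n B) \<longleftrightarrow> perp A B"
  using perp_shift[OF assms(1) shO_in[OF assms(2)], of n n] shO_inverse[OF assms(2)] by simp

lemma iso_arrow_shift:
  assumes "iso_arrow D f X Y"
  shows "iso_arrow D (shA D n f) (shO D n X) (shO D n Y)"
proof -
  obtain g where g: "g \<in> Hom D Y X" "g \<odot> f = Ident D X" "f \<odot> g = Ident D Y"
    using iso_arrow_inverse[OF assms] by blast
  have f: "f \<in> Hom D X Y" using assms by (simp add: iso_arrow_def)
  show ?thesis
    unfolding iso_arrow_def
    using shA_in[OF f, of n] shA_in[OF g(1), of n] shA_Cmp[OF f g(1), of n] shA_Cmp[OF g(1) f, of n]
      g(2,3) shA_Ident[of X n] shA_Ident[of Y n] Hom_objects[OF f]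
    by (auto intro!: bexI[of _ "shA D n g"])
qed

section \<open>Torsion pairs and truncation functors\<close>

text \<open>
  The common ground of t-structures, as \<open>(\<DD>\<^sup>\<le>\<^sup>n, \<DD>\<^sup>\<ge>\<^sup>n\<^sup>+\<^sup>1)\<close>, and of baric structures, as
  \<open>(\<DD>\<^sub>\<le>\<^sub>w, \<DD>\<^sub>\<ge>\<^sub>w\<^sub>+\<^sub>1)\<close>.  Closure of \<open>S\<close> under \<open>[1]\<close> is what makes the decompositions functorial: arrows
  from \<open>S\<close> to \<open>T[-1]\<close> vanish as well.
\<close>

definition torsion_pair :: "'o set \<Rightarrow> 'o set \<Rightarrow> bool" where
  "torsion_pair S T \<longleftrightarrow> strictly_full D S \<and> strictly_full D T \<and> Hom_vanishes D S T \<and>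
    decomposes D S T \<and> (\<forall>X \<in> S. shO D 1 X \<in> S)"

lemma
  assumes "torsion_pair S T"
  shows torsion_pair_objects_left: "X \<in> S \<Longrightarrow> X \<in> Ob D"
    and torsion_pair_objects_right: "X \<in> T \<Longrightarrow> X \<in> Ob D"
    and torsion_pair_perp: "A \<in> S \<Longrightarrow> B \<in> T \<Longrightarrow> perp A B"
    and torsion_pair_shift: "A \<in> S \<Longrightarrow> shO D 1 A \<in> S"
  using assms by (auto simp: torsion_pair_def strictly_full_def Hom_vanishes_def perp_def)

lemma torsion_pair_decompose:
  assumes "torsion_pair S T" "X \<in> Ob D"
  obtains A B where "A \<in> S" "B \<in> T" "tri A X B"
  using assms unfolding torsion_pair_def decomposes_def tri_def by metis

text \<open>
  If the arrow \<open>Y \<rightarrow> B\<close> vanishes, the identity of \<open>B\<close> factors through \<open>A[1]\<close>, which still lies in \<open>S\<close>.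
  Hence \<open>B\<close> is zero and \<open>A \<rightarrow> Y\<close> an isomorphism.
\<close>

lemma torsion_pair_left_if_perp:
  assumes P: "torsion_pair S T" and t: "tri A Y B" and A: "A \<in> S" and B: "B \<in> T" and Y: "perp Y B"
  shows "Y \<in> S"
proof -
  have "perp (shO D 1 A) B" using torsion_pair_perp[OF P torsion_pair_shift[OF P A] B] .
  then have "perp B B" by (rule perp_extension_left[OF tri_rotate[OF t] Y])
  then have "zero_object D B" by (rule zero_object_if_perp_self)
  moreover obtain f g h where "dist_triangle D A Y B f g h" using t by (auto simp: tri_def)
  ultimately have "iso_arrow D f A Y" by (metis dist_triangle_zero_iso)
  then show ?thesis using P A unfolding torsion_pair_def strictly_full_def by blast
qed

text \<open>
  Dually: if \<open>A \<rightarrow> Y\<close> vanishes, the identity of \<open>A\<close> factors through \<open>B[-1]\<close>, so \<open>A\<close> is zero.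
\<close>

lemma torsion_pair_right_if_perp:
  assumes P: "torsion_pair S T" and t: "tri A Y B" and A: "A \<in> S" and B: "B \<in> T" and Y: "perp A Y"
  shows "Y \<in> T"
proof -
  have "perp (shO D 1 A) B" using torsion_pair_perp[OF P torsion_pair_shift[OF P A] B] .
  then have "perp A (shO D (- 1) B)" using perp_shift tri_objects[OF t] by blast
  then have "perp A A" using perp_extension_right[OF tri_rotate_back[OF t] _ Y] by blast
  then have z: "zero_object D (shO D 1 A)" by (intro zero_object_shift zero_object_if_perp_self)
  obtain f g h where T: "dist_triangle D A Y B f g h" using t by (auto simp: tri_def)
  have "iso_arrow D g Y B" by (rule dist_triangle_zero_iso[OF dist_triangle_rotate[OF T] z])
  then obtain i where "iso_arrow D i B Y" by (auto elim: iso_arrow_inverse)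
  then show ?thesis using P B unfolding torsion_pair_def strictly_full_def by blast
qed

lemma torsion_pair_left_iff:
  assumes P: "torsion_pair S T"
  shows "X \<in> S \<longleftrightarrow> X \<in> Ob D \<and> (\<forall>B \<in> T. perp X B)"
proof
  assume *: "X \<in> Ob D \<and> (\<forall>B \<in> T. perp X B)"
  then obtain A B where "A \<in> S" "B \<in> T" "tri A X B" using torsion_pair_decompose[OF P] by blast
  then show "X \<in> S" using * torsion_pair_left_if_perp[OF P] by blast
qed (use torsion_pair_objects_left[OF P] torsion_pair_perp[OF P] in blast)

lemma torsion_pair_right_iff:
  assumes P: "torsion_pair S T"
  shows "X \<in> T \<longleftrightarrow> X \<in> Ob D \<and> (\<forall>A \<in> S. perp A X)"
proof
  assume *: "X \<in> Ob D \<and> (\<forall>A \<in> S. perp A X)"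
  then obtain A B where "A \<in> S" "B \<in> T" "tri A X B" using torsion_pair_decompose[OF P] by blast
  then show "X \<in> T" using * torsion_pair_right_if_perp[OF P] by blast
qed (use torsion_pair_objects_right[OF P] torsion_pair_perp[OF P] in blast)

lemma Hom_full_sub:
  "A \<in> S \<Longrightarrow> B \<in> S \<Longrightarrow> Hom (full_sub D S) A B = Hom D A B"
  by (auto simp: Hom_def full_sub_def)

lemma full_sub_simps:
  "Ob (full_sub D S) = Ob D \<inter> S" "Cmp (full_sub D S) = Cmp D" "Ident (full_sub D S) = Ident D"
  by (simp_all add: full_sub_def)

text \<open>
  Both \<open>A\<close> and the value \<open>l X\<close> of the right adjoint represent the functor \<open>Hom(_, X)\<close> on \<open>S\<close>, so the
  Yoneda argument makes them isomorphic.  For \<open>A\<close> this is the vanishing of arrows from \<open>S\<close> to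
  \<open>B\<close> and to \<open>B[-1]\<close>.
\<close>

lemma right_adjoint_iso:
  assumes P: "torsion_pair S T" and adj: "adjunction (full_sub D S) D inclusion l"
    and T: "dist_triangle D A X B f g h" and A: "A \<in> S" and B: "B \<in> T"
  shows "fob l X \<in> S" "\<exists>u. iso_arrow D u A (fob l X)"
proof -
  note a = dist_triangle_arrows[OF T]
  note ob = dist_triangle_objects[OF T]
  define L where "L = fob l X"
  have fl: "is_functor D (full_sub D S) l" using adj by (simp add: adjunction_def)
  then have L: "L \<in> S" "L \<in> Ob D"
    using ob(2) by (auto simp: is_functor_def full_sub_simps L_def)
  show "fob l X \<in> S" using L by (simp add: L_def)
  have lid: "far l (Ident D X) = Ident D L"
    using fl ob(2) by (auto simp: is_functor_def full_sub_simps L_def)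
  obtain \<phi> where bij: "\<forall>A \<in> Ob (full_sub D S). \<forall>X \<in> Ob D.
      bij_betw (\<phi> A X) (Hom D A X) (Hom (full_sub D S) A (fob l X))"
    and nat: "\<forall>A \<in> Ob (full_sub D S). \<forall>A' \<in> Ob (full_sub D S). \<forall>X \<in> Ob D. \<forall>X' \<in> Ob D.
        \<forall>a \<in> Hom (full_sub D S) A' A. \<forall>x \<in> Hom D X X'. \<forall>f \<in> Hom D A X.
          \<phi> A' X' (x \<odot> f \<odot> a) = far l x \<odot>\<^bsub>full_sub D S\<^esub> \<phi> A X f \<odot>\<^bsub>full_sub D S\<^esub> a"
    using adj unfolding adjunction_def inclusion_def cat_functor.simps by blast
  have bij': "bij_betw (\<phi> A' X) (Hom D A' X) (Hom D A' L)" if "A' \<in> S" for A'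
    using bij[rule_format, of A' X] ob(2) that torsion_pair_objects_left[OF P that] L
    by (auto simp: full_sub_simps Hom_full_sub L_def)
  have nat': "\<phi> A'' X (x \<odot> b) = \<phi> A' X x \<odot> b"
    if "A' \<in> S" "A'' \<in> S" "b \<in> Hom D A'' A'" "x \<in> Hom D A' X" for A' A'' b x
  proof -
    have p: "\<phi> A' X x \<in> Hom D A' L" using bij'[OF that(1)] that(4) by (auto simp: bij_betw_def)
    have "\<phi> A'' X (Ident D X \<odot> x \<odot> b) = far l (Ident D X) \<odot> \<phi> A' X x \<odot> b"
      using nat[rule_format, of A' A'' X X b "Ident D X" x] that ob(2) Ident_in[OF ob(2)]
        torsion_pair_objects_left[OF P]
      by (simp add: full_sub_simps Hom_full_sub)
    then show ?thesis using lid Ident_left[OF p] Ident_left[OF that(4)] by simp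
  qed
  define u where "u = \<phi> A X f"
  have u: "u \<in> Hom D A L" using bij'[OF A] a(1) by (auto simp: bij_betw_def u_def)
  \<comment> \<open>\<open>e\<close> is the counit at \<open>X\<close>\<close>
  obtain e where e: "e \<in> Hom D L X" "\<phi> L X e = Ident D L"
    using bij'[OF L(1)] Ident_in[OF L(2)] unfolding bij_betw_def by (metis imageE)
  have "g \<odot> e = Hzero D L B"
    using perpD[OF torsion_pair_perp[OF P L(1) B] Cmp_in[OF e(1) a(2)]] .
  from weak_kernel[OF T e(1) this] obtain v where v: "v \<in> Hom D L A" "e = f \<odot> v" .
  have uv: "u \<odot> v = Ident D L"
    using nat'[OF A L(1) v(1) a(1)] e(2) v(2) by (simp add: u_def)
  have "\<phi> A X (e \<odot> u) = \<phi> A X f"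
    using nat'[OF L(1) A u e(1)] e(2) Ident_left[OF u] by (simp add: u_def)
  then have "e \<odot> u = f"
    using bij'[OF A] a(1) Cmp_in[OF u e(1)] unfolding bij_betw_def inj_on_def by blast
  then have "f \<odot> (v \<odot> u) = f \<odot> Ident D A"
    using v(2) Cmp_assoc[OF u v(1) a(1)] Ident_right[OF a(1)] by simp
  moreover have "perp A (shO D (- 1) B)"
    using torsion_pair_perp[OF P torsion_pair_shift[OF P A] B] perp_shift[OF ob(1,3)] by blast
  ultimately have "v \<odot> u = Ident D A"
    using dist_triangle_cancel_left[OF T _ Cmp_in[OF u v(1)] Ident_in[OF ob(1)]] by blast
  then show "\<exists>u. iso_arrow D u A (fob l X)"
    using u v(1) uv unfolding iso_arrow_def L_def by blast
qed

text \<open>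
  The dual statement: \<open>B\<close> and \<open>r X\<close> both represent \<open>Hom(X, _)\<close> on \<open>T\<close>.
\<close>

lemma left_adjoint_iso:
  assumes P: "torsion_pair S T" and adj: "adjunction D (full_sub D T) r inclusion"
    and T: "dist_triangle D A X B f g h" and A: "A \<in> S" and B: "B \<in> T"
  shows "fob r X \<in> T" "\<exists>u. iso_arrow D u B (fob r X)"
proof -
  note a = dist_triangle_arrows[OF T]
  note ob = dist_triangle_objects[OF T]
  define R where "R = fob r X"
  have fr: "is_functor D (full_sub D T) r" using adj by (simp add: adjunction_def)
  then have R: "R \<in> T" "R \<in> Ob D"
    using ob(2) by (auto simp: is_functor_def full_sub_simps R_def)
  show "fob r X \<in> T" using R by (simp add: R_def)
  have rid: "far r (Ident D X) = Ident D R"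
    using fr ob(2) by (auto simp: is_functor_def full_sub_simps R_def)
  obtain \<phi> where bij: "\<forall>A \<in> Ob D. \<forall>X \<in> Ob (full_sub D T).
      bij_betw (\<phi> A X) (Hom (full_sub D T) (fob r A) X) (Hom D A X)"
    and nat: "\<forall>A \<in> Ob D. \<forall>A' \<in> Ob D. \<forall>X \<in> Ob (full_sub D T). \<forall>X' \<in> Ob (full_sub D T).
        \<forall>a \<in> Hom D A' A. \<forall>x \<in> Hom (full_sub D T) X X'. \<forall>f \<in> Hom (full_sub D T) (fob r A) X.
          \<phi> A' X' (x \<odot>\<^bsub>full_sub D T\<^esub> f \<odot>\<^bsub>full_sub D T\<^esub> far r a) = x \<odot> \<phi> A X f \<odot> a"
    using adj unfolding adjunction_def inclusion_def cat_functor.simps by blast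
  have bij': "bij_betw (\<phi> X B') (Hom D R B') (Hom D X B')" if "B' \<in> T" for B'
    using bij[rule_format, of X B'] ob(2) that torsion_pair_objects_right[OF P that] R
    by (auto simp: full_sub_simps Hom_full_sub R_def)
  have nat': "\<phi> X B'' (b \<odot> x) = b \<odot> \<phi> X B' x"
    if "B' \<in> T" "B'' \<in> T" "b \<in> Hom D B' B''" "x \<in> Hom D R B'" for B' B'' b x
  proof -
    have p: "\<phi> X B' x \<in> Hom D X B'" using bij'[OF that(1)] that(4) by (auto simp: bij_betw_def)
    have "\<phi> X B'' (b \<odot> x \<odot> far r (Ident D X)) = b \<odot> \<phi> X B' x \<odot> Ident D X"
      using nat[rule_format, of X X B' B'' "Ident D X" b x] that ob(2) Ident_in[OF ob(2)]
        torsion_pair_objects_right[OF P] R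
      by (simp add: full_sub_simps Hom_full_sub R_def)
    then show ?thesis
      using rid Ident_right[OF Cmp_in[OF that(4,3)]] Ident_right[OF Cmp_in[OF p that(3)]] by simp
  qed
  \<comment> \<open>\<open>e\<close> is the unit at \<open>X\<close>\<close>
  define e where "e = \<phi> X R (Ident D R)"
  have e: "e \<in> Hom D X R"
    using bij'[OF R(1)] Ident_in[OF R(2)] by (auto simp: bij_betw_def e_def)
  obtain w where w: "w \<in> Hom D R B" "\<phi> X B w = g"
    using bij'[OF B] a(2) unfolding bij_betw_def by (metis imageE)
  have "e \<odot> f = Hzero D A R"
    using perpD[OF torsion_pair_perp[OF P A R(1)] Cmp_in[OF a(1) e(1)]] .
  from weak_cokernel[OF T e this] obtain v where v: "v \<in> Hom D B R" "e = v \<odot> g" .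
  have we: "w \<odot> e = g"
    using nat'[OF R(1) B w(1) Ident_in[OF R(2)]] Ident_right[OF w(1)] w(2) by (simp add: e_def)
  have "\<phi> X R (v \<odot> w) = \<phi> X R (Ident D R)"
    using nat'[OF B R(1) v(1) w(1)] w(2) v(2) by (simp add: e_def)
  then have vw: "v \<odot> w = Ident D R"
    using bij'[OF R(1)] Ident_in[OF R(2)] Cmp_in[OF w(1) v(1)] unfolding bij_betw_def inj_on_def
    by blast
  have "(w \<odot> v) \<odot> g = Ident D B \<odot> g"
    using we v(2) Cmp_assoc[OF a(2) v(1) w(1)] Ident_left[OF a(2)] by simp
  then have "w \<odot> v = Ident D B"
    using dist_triangle_cancel_right[OF T _ Cmp_in[OF v(1) w(1)] Ident_in[OF ob(3)]]
      torsion_pair_perp[OF P torsion_pair_shift[OF P A] B] by blast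
  then show "\<exists>u. iso_arrow D u B (fob r X)"
    using w(1) v(1) vw unfolding iso_arrow_def R_def by blast
qed

lemma tri_truncation:
  assumes P: "torsion_pair S T" and l: "adjunction (full_sub D S) D inclusion l"
    and r: "adjunction D (full_sub D T) r inclusion" and X: "X \<in> Ob D"
  shows "fob l X \<in> S" "fob r X \<in> T" "tri (fob l X) X (fob r X)"
proof -
  obtain A B where AB: "A \<in> S" "B \<in> T" "tri A X B" using torsion_pair_decompose[OF P X] .
  then obtain f g h where T: "dist_triangle D A X B f g h" by (auto simp: tri_def)
  note L = right_adjoint_iso[OF P l T AB(1,2)]
  note R = left_adjoint_iso[OF P r T AB(1,2)]
  show "fob l X \<in> S" "fob r X \<in> T" using L(1) R(1) .
  show "tri (fob l X) X (fob r X)" using dist_triangle_iso_ends[OF T] L(2) R(2) by blast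
qed

lemma mem_tpart:
  assumes "S \<subseteq> Ob D"
  shows "X \<in> tpart D S n \<longleftrightarrow> X \<in> Ob D \<and> shO D n X \<in> S"
proof
  assume "X \<in> tpart D S n"
  then obtain Y where "Y \<in> S" "X = shO D (- n) Y" by (auto simp: tpart_def)
  then show "X \<in> Ob D \<and> shO D n X \<in> S" using assms shO_in shO_inverse by auto
next
  assume *: "X \<in> Ob D \<and> shO D n X \<in> S"
  then have "X = shO D (- n) (shO D n X)" using shO_inverse by simp
  then show "X \<in> tpart D S n" unfolding tpart_def using * by blast
qed

lemma strictly_full_tpart:
  assumes "strictly_full D S"
  shows "strictly_full D (tpart D S n)"
proof -
  have S: "S \<subseteq> Ob D" using assms by (simp add: strictly_full_def)
  have "Y \<in> tpart D S n" if X: "X \<in> tpart D S n" and f: "iso_arrow D f X Y" for X Y f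
  proof -
    have "Y \<in> Ob D" using f Hom_objects(2)[of f X Y] by (simp add: iso_arrow_def)
    moreover have "shO D n Y \<in> S"
      using iso_arrow_shift[OF f, of n] X assms unfolding mem_tpart[OF S] strictly_full_def by blast
    ultimately show ?thesis by (simp add: mem_tpart[OF S])
  qed
  then show ?thesis unfolding strictly_full_def using mem_tpart[OF S] by blast
qed

lemma t_structure_torsion_pair:
  assumes "t_structure D Tle Tge"
  shows "torsion_pair (tpart D Tle n) (tpart D Tge (n + 1))"
proof -
  have sf: "strictly_full D Tle" "strictly_full D Tge"
    and inc: "Tle \<subseteq> tpart D Tle 1"
    and hv: "Hom_vanishes D Tle (tpart D Tge 1)" and dc: "decomposes D Tle (tpart D Tge 1)"
    using assms by (auto simp: t_structure_def)
  have S: "Tle \<subseteq> Ob D" "Tge \<subseteq> Ob D" using sf by (auto simp: strictly_full_def)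
  note mem = mem_tpart[OF S(1)] mem_tpart[OF S(2)]
  have "Hom_vanishes D (tpart D Tle n) (tpart D Tge (n + 1))"
    unfolding Hom_vanishes_def perp_def[symmetric]
  proof (intro ballI)
    fix A B assume AB: "A \<in> tpart D Tle n" "B \<in> tpart D Tge (n + 1)"
    then have "shO D n A \<in> Tle" "shO D n B \<in> tpart D Tge 1"
      by (auto simp: mem shO_in shO_shO add.commute)
    then have "perp (shO D n A) (shO D n B)"
      using hv unfolding Hom_vanishes_def perp_def[symmetric] by blast
    then show "perp A B" using perp_shift_shift AB by (auto simp: mem)
  qed
  moreover have "decomposes D (tpart D Tle n) (tpart D Tge (n + 1))"
    unfolding decomposes_def tri_def[symmetric]
  proof
    fix X assume X: "X \<in> Ob D"
    obtain A B where AB: "A \<in> Tle" "B \<in> tpart D Tge 1" "tri A (shO D n X) B"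
      using dc shO_in[OF X, of n] unfolding decomposes_def tri_def[symmetric] by blast
    have o: "A \<in> Ob D" "B \<in> Ob D" using tri_objects[OF AB(3)] by blast+
    have "tri (shO D (- n) A) X (shO D (- n) B)"
      using tri_shift[OF AB(3), of "- n"] shO_inverse[OF X] by simp
    moreover have "shO D (- n) A \<in> tpart D Tle n" "shO D (- n) B \<in> tpart D Tge (n + 1)"
      using AB o by (simp_all add: mem shO_in shO_shO Shift_0_ob)
    ultimately show "\<exists>A \<in> tpart D Tle n. \<exists>B \<in> tpart D Tge (n + 1). tri A X B" by blast
  qed
  moreover have "shO D 1 X \<in> tpart D Tle n" if "X \<in> tpart D Tle n" for X
    using that subsetD[OF inc, of "shO D n X"] by (auto simp: mem shO_in shO_shO add.commute)
  ultimately show ?thesis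
    unfolding torsion_pair_def using sf strictly_full_tpart by blast
qed

lemma baric_structure_torsion_pair:
  assumes "baric_structure D Ble Bge"
  shows "torsion_pair (Ble w) (Bge (w + 1))"
  using assms by (auto simp: baric_structure_def torsion_pair_def thick_def)

text \<open>
  An object lying in every \<open>\<DD>\<^sup>\<le>\<^sup>n\<close> (or in every \<open>\<DD>\<^sup>\<ge>\<^sup>n\<close>) is orthogonal to itself as soon as it also
  lies in a single class of the other kind.
\<close>

lemma t_nondegenerate_if_bounded:
  assumes t: "t_structure D Tle Tge" and b: "t_bounded D Tle Tge"
  shows "t_nondegenerate D Tle Tge"
  unfolding t_nondegenerate_def nondegenerate_family_def
proof (intro ballI conjI impI)
  fix X assume "X \<in> Ob D"
  then obtain m n where mn: "X \<in> tpart D Tge m" "X \<in> tpart D Tle n"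
    using b by (auto simp: t_bounded_def bounded_family_def)
  note pp = torsion_pair_perp[OF t_structure_torsion_pair[OF t]]
  show "zero_object D X" if "\<forall>n. X \<in> tpart D Tle n"
    using that mn(1) pp[of X "m - 1" X] zero_object_if_perp_self by simp
  show "zero_object D X" if "\<forall>n. X \<in> tpart D Tge n"
    using that mn(2) pp[of X n X] zero_object_if_perp_self by simp
qed

end

section \<open>Compatible t-structures and baric structures\<close>

locale compatible_structures = triangulated_category D
  for D :: "('o, 'm, 'z) tri_category_scheme" (structure) +
  fixes Tle Tge :: "'o set"
    and tle tge :: "int \<Rightarrow> ('o, 'm, 'o, 'm) cat_functor"
    and Ble Bge :: "int \<Rightarrow> 'o set"
    and ble bge :: "int \<Rightarrow> ('o, 'm, 'o, 'm) cat_functor"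
  assumes t_str: "t_structure D Tle Tge"
    and t_bdd: "t_bounded D Tle Tge"
    and t_trunc: "truncations D (tpart D Tle) (tpart D Tge) tle tge"
    and b_str: "baric_structure D Ble Bge"
    and b_bdd: "bounded_family D Ble Bge"
    and b_trunc: "truncations D Ble Bge ble bge"
    and compat: "compatible D Tge tle tge Ble ble bge"
begin

abbreviation Dle :: "int \<Rightarrow> 'o set" where "Dle \<equiv> tpart D Tle"
abbreviation Dge :: "int \<Rightarrow> 'o set" where "Dge \<equiv> tpart D Tge"

lemma Tle_objects: "Tle \<subseteq> Ob D" and Tge_objects: "Tge \<subseteq> Ob D"
  using t_str by (auto simp: t_structure_def strictly_full_def)

lemmas mem_Dle = mem_tpart[OF Tle_objects]
lemmas mem_Dge = mem_tpart[OF Tge_objects]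

lemma t_pair: "torsion_pair (Dle n) (Dge (n + 1))"
  by (rule t_structure_torsion_pair[OF t_str])

lemma baric_pair: "torsion_pair (Ble w) (Bge (w + 1))"
  by (rule baric_structure_torsion_pair[OF b_str])

lemma shift_Dle: "X \<in> Ob D \<Longrightarrow> shO D k X \<in> Dle n \<longleftrightarrow> X \<in> Dle (n + k)"
  by (simp add: mem_Dle shO_in shO_shO)

lemma shift_Dge: "X \<in> Ob D \<Longrightarrow> shO D k X \<in> Dge n \<longleftrightarrow> X \<in> Dge (n + k)"
  by (simp add: mem_Dge shO_in shO_shO)

lemma Dle_mono: "m \<le> n \<Longrightarrow> Dle m \<subseteq> Dle n"
proof (induction n rule: int_ge_induct)
  case (step i)
  have "X \<in> Dle (i + 1)" if "X \<in> Dle i" for X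
  proof -
    have X: "X \<in> Ob D" "shO D i X \<in> Tle" using that by (simp_all add: mem_Dle)
    then have "shO D i X \<in> Dle 1" using t_str by (auto simp: t_structure_def)
    then show ?thesis using X by (simp add: shift_Dle add.commute)
  qed
  then show ?case using step by blast
qed simp

lemma Dge_antimono: "m \<le> n \<Longrightarrow> Dge n \<subseteq> Dge m"
proof (induction n rule: int_ge_induct)
  case (step i)
  have "X \<in> Dge i" if "X \<in> Dge (i + 1)" for X
  proof -
    have X: "X \<in> Ob D" using that by (simp add: mem_Dge)
    then have "shO D i X \<in> Dge 1" using that by (simp add: shift_Dge add.commute)
    then have "shO D i X \<in> Tge" using t_str by (auto simp: t_structure_def)
    then show ?thesis using X by (simp add: mem_Dge)
  qed
  then show ?case using step by blast
qed simp

lemma Bge_antimono: "v \<le> w \<Longrightarrow> Bge w \<subseteq> Bge v"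
proof (induction w rule: int_ge_induct)
  case (step i)
  then show ?case using b_str by (auto simp: baric_structure_def)
qed simp

lemma Ble_objects: "X \<in> Ble w \<Longrightarrow> X \<in> Ob D" and Bge_objects: "X \<in> Bge w \<Longrightarrow> X \<in> Ob D"
  using b_str by (auto simp: baric_structure_def thick_def strictly_full_def)

lemma shift_Ble: "X \<in> Ble w \<Longrightarrow> shO D n X \<in> Ble w"
  and shift_Bge: "X \<in> Bge w \<Longrightarrow> shO D n X \<in> Bge w"
  using b_str by (auto simp: baric_structure_def thick_def)

lemma perp_t:
  assumes "A \<in> Dle m" "B \<in> Dge n" "m < n"
  shows "perp A B"
  using torsion_pair_perp[OF t_pair assms(1)] assms(2) Dge_antimono[of "m + 1" n] assms(3) by auto

lemma perp_baric:
  assumes "A \<in> Ble v" "B \<in> Bge w" "v < w"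
  shows "perp A B"
  using torsion_pair_perp[OF baric_pair assms(1)] assms(2) Bge_antimono[of "v + 1" w] assms(3)
  by auto

lemma
  assumes "X \<in> Ob D"
  shows tle_in: "fob (tle n) X \<in> Dle n" and tge_in: "fob (tge (n + 1)) X \<in> Dge (n + 1)"
    and t_tri: "tri (fob (tle n) X) X (fob (tge (n + 1)) X)"
  using tri_truncation[OF t_pair _ _ assms, of n "tle n" "tge (n + 1)"] t_trunc
  by (auto simp: truncations_def)

lemma
  assumes "X \<in> Ob D"
  shows ble_in: "fob (ble w) X \<in> Ble w" and bge_in: "fob (bge (w + 1)) X \<in> Bge (w + 1)"
    and b_tri: "tri (fob (ble w) X) X (fob (bge (w + 1)) X)"
  using tri_truncation[OF baric_pair _ _ assms, of w "ble w" "bge (w + 1)"] b_trunc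
  by (auto simp: truncations_def)

lemma tle_Ble: "X \<in> Ble w \<Longrightarrow> fob (tle n) X \<in> Ble w"
  and bge_Dge: "X \<in> Dge n \<Longrightarrow> fob (bge w) X \<in> Dge n"
  using compat by (auto simp: compatible_def)

lemma Dle_eq: "X \<in> Dle n \<longleftrightarrow> X \<in> Ob D \<and> (\<forall>B \<in> Dge (n + 1). perp X B)"
  by (rule torsion_pair_left_iff[OF t_pair])

lemma Dge_eq: "X \<in> Dge (n + 1) \<longleftrightarrow> X \<in> Ob D \<and> (\<forall>A \<in> Dle n. perp A X)"
  by (rule torsion_pair_right_iff[OF t_pair])

lemma zero_object_Dge: "zero_object D Z \<Longrightarrow> Z \<in> Dge n"
  using Dge_eq[of Z "n - 1"] perp_zero_object(2) by (auto simp: zero_object_def mem_Dle)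

section \<open>Generators, cogenerators and their orthogonals\<close>

definition gens :: "'o set" where
  "gens = (\<Union>k. Ble k \<inter> Dle (- k))"

definition cogens :: "'o set" where
  "cogens = (\<Union>k. Bge (1 - k) \<inter> Dge k)"

lemma gensI: "A \<in> Ble k \<Longrightarrow> A \<in> Dle (- k) \<Longrightarrow> A \<in> gens"
  unfolding gens_def by blast

lemma cogensI: "B \<in> Bge (1 - k) \<Longrightarrow> B \<in> Dge k \<Longrightarrow> B \<in> cogens"
  unfolding cogens_def by blast

lemma gens_objects: "A \<in> gens \<Longrightarrow> A \<in> Ob D" and cogens_objects: "B \<in> cogens \<Longrightarrow> B \<in> Ob D"
  using Ble_objects Bge_objects unfolding cogens_def gens_def by blast+

lemma gens_shift: "A \<in> gens \<Longrightarrow> shO D 1 A \<in> gens"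
proof -
  assume "A \<in> gens"
  then obtain k where A: "A \<in> Ble k" "A \<in> Dle (- k)" by (auto simp: gens_def)
  show "shO D 1 A \<in> gens"
    using gensI[OF shift_Ble[OF A(1)]] torsion_pair_shift[OF t_pair A(2)] by blast
qed

lemma cogens_shift: "B \<in> cogens \<Longrightarrow> shO D (- 1) B \<in> cogens"
proof -
  assume "B \<in> cogens"
  then obtain k where B: "B \<in> Bge (1 - k)" "B \<in> Dge k" by (auto simp: cogens_def)
  have "shO D (- 1) B \<in> Dge (k + 1)" using shift_Dge[OF Bge_objects[OF B(1)]] B(2) by simp
  then have "shO D (- 1) B \<in> Dge k" using Dge_antimono[of k "k + 1"] by auto
  then show "shO D (- 1) B \<in> cogens" by (rule cogensI[OF shift_Bge[OF B(1)]])
qed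

text \<open>
  Either the degrees or the weights are separated: the index \<open>j\<close> of the generator and \<open>k\<close> of the
  cogenerator satisfy \<open>- j < k\<close> or \<open>j < 1 - k\<close>.
\<close>

lemma gens_perp_cogens:
  assumes "A \<in> gens" "B \<in> cogens"
  shows "perp A B"
proof -
  obtain j where A: "A \<in> Ble j" "A \<in> Dle (- j)" using assms(1) by (auto simp: gens_def)
  obtain k where B: "B \<in> Bge (1 - k)" "B \<in> Dge k" using assms(2) by (auto simp: cogens_def)
  show ?thesis
    using perp_t[OF A(2) B(2)] perp_baric[OF A(1) B(1)] by (cases "- j < k") auto
qed

text \<open>
  It will turn out that \<open>left_orth\<close> is \<open>\<^sup>s\<DD>\<^sup>\<le>\<^sup>0\<close> and that \<open>right_orth\<close> is \<open>\<^sup>s\<DD>\<^sup>\<ge>\<^sup>1\<close>.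
\<close>

definition left_orth :: "'o set" where
  "left_orth = {A \<in> Ob D. \<forall>B \<in> cogens. perp A B}"

definition right_orth :: "'o set" where
  "right_orth = {B \<in> Ob D. \<forall>A \<in> gens. perp A B}"

lemma left_orth_extension: "tri X Y Z \<Longrightarrow> X \<in> left_orth \<Longrightarrow> Z \<in> left_orth \<Longrightarrow> Y \<in> left_orth"
  unfolding left_orth_def by (auto intro: perp_extension_left tri_objects(2))

lemma right_orth_extension: "tri X Y Z \<Longrightarrow> X \<in> right_orth \<Longrightarrow> Z \<in> right_orth \<Longrightarrow> Y \<in> right_orth"
  unfolding right_orth_def by (auto intro: perp_extension_right tri_objects(2))

lemma gens_left_orth: "gens \<subseteq> left_orth" and cogens_right_orth: "cogens \<subseteq> right_orth"
  using gens_perp_cogens gens_objects cogens_objects unfolding left_orth_def right_orth_def by blast+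

lemma left_orth_strictly_full: "strictly_full D left_orth"
  unfolding strictly_full_def left_orth_def by (auto intro: perp_iso_left iso_arrow_objects(2))

lemma left_orth_shift: "A \<in> left_orth \<Longrightarrow> shO D 1 A \<in> left_orth"
  unfolding left_orth_def by (auto simp: perp_shift cogens_shift cogens_objects shO_in)

text \<open>
  Compatibility keeps the baric truncation \<open>\<beta>\<^sub>\<ge>\<^sub>1\<^sub>-\<^sub>n A\<close> in \<open>\<DD>\<^sup>\<ge>\<^sup>n\<close>, so it is a cogenerator and receives
  no nonzero arrow from \<open>A\<close>.
\<close>

lemma left_orth_Ble:
  assumes A: "A \<in> left_orth" "A \<in> Dge n"
  shows "A \<in> Ble (- n)"
proof -
  have Ao: "A \<in> Ob D" using A by (simp add: left_orth_def)
  note G = bge_in[OF Ao, of "- n"] b_tri[OF Ao, of "- n"]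
  have "fob (bge (- n + 1)) A \<in> cogens"
    using cogensI[of _ n] G(1) bge_Dge[OF A(2)] by (simp add: add.commute)
  then have "perp A (fob (bge (- n + 1)) A)" using A(1) by (simp add: left_orth_def)
  then show ?thesis by (rule torsion_pair_left_if_perp[OF baric_pair G(2) ble_in[OF Ao] G(1)])
qed

section \<open>Orthogonality of the staggered classes\<close>

text \<open>
  \<open>N\<close> counts the degrees \<open>n, \<dots>, n + N - 1\<close> in which \<open>A\<close> can have cohomology.  The part in the lowest
  degree is a generator by compatibility, and splitting it off leaves an object of \<open>left_orth\<close> because
  \<open>left_orth\<close> contains the shift by \<open>1\<close> of every generator.
\<close>

lemma left_orth_perp_right_orth_aux:
  assumes B: "B \<in> right_orth"
  shows "A \<in> left_orth \<Longrightarrow> A \<in> Dge n \<Longrightarrow> A \<in> Dle (n + int N - 1) \<Longrightarrow> perp A B"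
proof (induction N arbitrary: A n)
  case 0
  then have "perp A A" by (intro perp_t) auto
  then have "zero_object D A" by (rule zero_object_if_perp_self)
  then show ?case using B perp_zero_object by (simp add: right_orth_def)
next
  case (Suc N)
  have A: "A \<in> Ob D" using Suc.prems by (simp add: left_orth_def)
  define C where "C = fob (tle n) A"
  define A' where "A' = fob (tge (n + 1)) A"
  have C: "C \<in> Dle n" and A': "A' \<in> Dge (n + 1)" and t: "tri C A A'"
    unfolding C_def A'_def using tle_in[OF A] tge_in[OF A] t_tri[OF A] by blast+
  have C_gens: "C \<in> gens"
    using gensI[of C "- n"] C tle_Ble[OF left_orth_Ble[OF Suc.prems(1,2)]] by (simp add: C_def)
  have C1: "shO D 1 C \<in> left_orth" using gens_shift[OF C_gens] gens_left_orth by blast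
  note t' = tri_rotate[OF t]
  have "A' \<in> left_orth" by (rule left_orth_extension[OF t' Suc.prems(1) C1])
  moreover have "A' \<in> Dle (n + int N)"
    unfolding Dle_eq
  proof (intro conjI ballI)
    show "A' \<in> Ob D" using tri_objects[OF t] by blast
    fix E assume E: "E \<in> Dge (n + int N + 1)"
    have "perp A E" by (rule perp_t[OF Suc.prems(3) E]) simp
    moreover have "shO D 1 C \<in> Dle n" using torsion_pair_shift[OF t_pair C] .
    then have "perp (shO D 1 C) E" by (rule perp_t[OF _ E]) simp
    ultimately show "perp A' E" by (rule perp_extension_left[OF t'])
  qed
  ultimately have "perp A' B" using Suc.IH[OF _ A'] by simp
  moreover have "perp C B" using B C_gens by (simp add: right_orth_def)
  ultimately show ?case using perp_extension_left[OF t] by blast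
qed

lemma left_orth_perp_right_orth:
  assumes A: "A \<in> left_orth" and B: "B \<in> right_orth"
  shows "perp A B"
proof -
  obtain m n where mn: "A \<in> Dge m" "A \<in> Dle n"
    using A t_bdd by (auto simp: left_orth_def t_bounded_def bounded_family_def)
  have "Dle n \<subseteq> Dle (m + int (nat (n - m + 1)) - 1)" by (rule Dle_mono) simp
  then show ?thesis using left_orth_perp_right_orth_aux[OF B A mn(1)] mn(2) by blast
qed

section \<open>Decomposition\<close>

text \<open>
  The function \<open>\<mu>\<close> makes the recursion \<open>X \<mapsto> \<tau>\<^sup>\<ge>\<^sup>n\<^sup>+\<^sup>1 \<beta>\<^sub>\<le>\<^sub>-\<^sub>n X\<close> terminate, and everything that this
  operation removes from \<open>X\<close> is a generator or a cogenerator.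
\<close>

lemma staggered_decomposition:
  fixes \<mu> :: "'o \<Rightarrow> nat"
  assumes nondeg: "t_nondegenerate D Tle Tge"
    and \<mu>: "\<And>X n. X \<in> Dge n \<Longrightarrow> X \<notin> Dge (n + 1)
      \<Longrightarrow> \<mu> (fob (tge (n + 1)) (fob (ble (- n)) X)) < \<mu> X"
    and X: "X \<in> Ob D"
  shows "\<exists>A \<in> left_orth. \<exists>B \<in> right_orth. tri A X B"
  using X
proof (induction "\<mu> X" arbitrary: X rule: less_induct)
  case less
  note X = less.prems
  show ?case
  proof (cases "zero_object D X")
    case True
    then have "tri X X X" using tri_zero_right[OF X] by blast
    then show ?thesis
      using True X perp_zero_object cogens_objects gens_objects
      by (intro bexI[of _ X]) (auto simp: left_orth_def right_orth_def)
  next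
    case False
    obtain m where m: "X \<in> Dge m" using t_bdd X by (auto simp: t_bounded_def bounded_family_def)
    have "\<exists>n. X \<in> Dge n \<and> X \<notin> Dge (n + 1)"
    proof (rule ccontr)
      assume *: "\<nexists>n. X \<in> Dge n \<and> X \<notin> Dge (n + 1)"
      have up: "X \<in> Dge n" if "m \<le> n" for n
        using that by (induction n rule: int_ge_induct) (use m * in auto)
      have "X \<in> Dge n" for n
        using up[of "max m n"] Dge_antimono[of n "max m n"] by auto
      then show False
        using nondeg X False by (auto simp: t_nondegenerate_def nondegenerate_family_def)
    qed
    then obtain n where n: "X \<in> Dge n" "X \<notin> Dge (n + 1)" by blast
    define Y where "Y = fob (ble (- n)) X"
    define Z where "Z = fob (bge (- n + 1)) X"
    define C where "C = fob (tle n) Y"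
    define X' where "X' = fob (tge (n + 1)) Y"
    have Y: "Y \<in> Ble (- n)" and Z: "Z \<in> Bge (- n + 1)" and YXZ: "tri Y X Z"
      unfolding Y_def Z_def using ble_in[OF X] bge_in[OF X] b_tri[OF X] by blast+
    have Yo: "Y \<in> Ob D" by (rule Ble_objects[OF Y])
    have C: "C \<in> Dle n" and CYX': "tri C Y X'"
      unfolding C_def X'_def using tle_in[OF Yo] t_tri[OF Yo] by blast+
    have "C \<in> gens" using gensI[of C "- n"] C tle_Ble[OF Y] by (simp add: C_def)
    then have C_left: "C \<in> left_orth" using gens_left_orth by blast
    have "Z \<in> cogens" using cogensI[of Z n] Z bge_Dge[OF n(1)] by (simp add: Z_def add.commute)
    then have Z_right: "Z \<in> right_orth" using cogens_right_orth by blast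
    have "\<mu> X' < \<mu> X" using \<mu>[OF n] by (simp add: X'_def Y_def)
    then obtain A' B' where A': "A' \<in> left_orth" and B': "B' \<in> right_orth" and t: "tri A' X' B'"
      using less.hyps tri_objects(3)[OF CYX'] by blast
    \<comment> \<open>First octahedron, on the composite of \<open>Y \<rightarrow> X'\<close> and \<open>X' \<rightarrow> B'\<close>: its fibre \<open>A\<close> is an extension of \<open>A'\<close> by \<open>C\<close>.\<close>
    obtain E where E: "tri Y B' E" "tri (shO D 1 C) E (shO D 1 A')"
      using tri_octahedron[OF tri_rotate[OF CYX'] tri_rotate[OF t]] .
    define A where "A = shO D (- 1) E"
    have AYB: "tri A Y B'" unfolding A_def by (rule tri_rotate_back[OF E(1)])
    have "tri C A A'"
      using tri_shift[OF E(2), of "- 1"] tri_objects[OF CYX'] tri_objects[OF t]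
      by (simp add: A_def shO_inverse)
    then have A_left: "A \<in> left_orth" by (rule left_orth_extension[OF _ C_left A'])
    \<comment> \<open>Second octahedron, on the composite of \<open>A \<rightarrow> Y\<close> and \<open>Y \<rightarrow> X\<close>: its cone is an extension of \<open>Z\<close> by \<open>B'\<close>.\<close>
    obtain B where B: "tri A X B" "tri B' B Z" using tri_octahedron[OF AYB YXZ] .
    have "B \<in> right_orth" by (rule right_orth_extension[OF B(2) B' Z_right])
    then show ?thesis using A_left B(1) by blast
  qed
qed

section \<open>The staggered classes as orthogonals\<close>

text \<open>
  Write \<open>E = A[k]\<close>.  For \<open>F = \<tau>\<^sup>\<ge>\<^sup>0 \<tau>\<^sup>\<le>\<^sup>0 E\<close> it suffices that the arrow from \<open>F\<close> to its baric truncation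
  \<open>G = \<beta>\<^sub>\<ge>\<^sub>1\<^sub>-\<^sub>k F\<close> vanishes.  By compatibility \<open>G\<close> is a shift of a cogenerator, so \<open>E\<close> has no nonzero arrow
  to \<open>G\<close>.  The objects by which \<open>F\<close> differs from \<open>E\<close> have none either: \<open>\<tau>\<^sup>\<le>\<^sup>-\<^sup>1\<close> for degree reasons, and
  \<open>\<tau>\<^sup>\<ge>\<^sup>1 E\<close> because it has weights at most \<open>- k - 1\<close>.
\<close>

lemma left_orth_cohomology:
  assumes A: "A \<in> left_orth"
  shows "cohomology D tle tge k A \<in> Ble (- k)"
proof -
  have Ao: "A \<in> Ob D" using A by (simp add: left_orth_def)
  define E where "E = shO D k A"
  have E: "E \<in> Ob D" unfolding E_def by (rule shO_in[OF Ao])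
  have EG: "perp E G" if "G \<in> Bge (1 - j)" "G \<in> Dge (j - k)" for G j
  proof -
    have Go: "G \<in> Ob D" by (rule Bge_objects[OF that(1)])
    have "shO D (- k) G \<in> cogens"
      using cogensI[of _ j] shift_Bge[OF that(1)] shift_Dge[OF Go] that(2) by simp
    then show ?thesis using A perp_shift[OF Ao Go] by (simp add: left_orth_def E_def)
  qed
  define E0 where "E0 = fob (tle 0) E"
  define E1 where "E1 = fob (tge 1) E"
  have E0: "E0 \<in> Dle 0" and E1: "E1 \<in> Dge 1" and tE: "tri E0 E E1"
    unfolding E0_def E1_def using tle_in[OF E, of 0] tge_in[OF E, of 0] t_tri[OF E, of 0] by simp_all
  have o: "E0 \<in> Ob D" "E1 \<in> Ob D" using tri_objects[OF tE] by blast+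
  \<comment> \<open>The same argument one degree higher, where a single truncation is involved\<close>
  have E1B: "E1 \<in> Ble (- k - 1)"
  proof -
    define G where "G = fob (bge (- k)) E1"
    have G: "G \<in> Bge (- k)" and t: "tri (fob (ble (- k - 1)) E1) E1 G"
      unfolding G_def using bge_in[OF o(2), of "- k - 1"] b_tri[OF o(2), of "- k - 1"] by simp_all
    have Gge: "G \<in> Dge 1" unfolding G_def by (rule bge_Dge[OF E1])
    have "perp E G" by (rule EG[of _ "k + 1"]) (use G Gge in simp_all)
    moreover have "perp (shO D 1 E0) G"
      by (rule perp_t[OF torsion_pair_shift[OF t_pair E0] Gge]) simp
    ultimately have "perp E1 G" by (rule perp_extension_left[OF tri_rotate[OF tE]])
    moreover have "torsion_pair (Ble (- k - 1)) (Bge (- k))" using baric_pair[of "- k - 1"] by simp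
    ultimately show ?thesis using torsion_pair_left_if_perp t ble_in[OF o(2)] G by blast
  qed
  define F where "F = fob (tge 0) E0"
  define W where "W = fob (tle (- 1)) E0"
  have F: "F \<in> Dge 0" and W: "W \<in> Dle (- 1)" and tF: "tri W E0 F"
    unfolding F_def W_def using tle_in[OF o(1), of "- 1"] tge_in[OF o(1), of "- 1"] t_tri[OF o(1), of "- 1"]
    by simp_all
  have Fo: "F \<in> Ob D" using tri_objects[OF tF] by blast
  define G where "G = fob (bge (- k + 1)) F"
  have G: "G \<in> Bge (- k + 1)" and t: "tri (fob (ble (- k)) F) F G"
    unfolding G_def using bge_in[OF Fo] b_tri[OF Fo] by blast+
  have Gge: "G \<in> Dge 0" unfolding G_def by (rule bge_Dge[OF F])
  have "perp E G" by (rule EG[of _ k]) (use G Gge in \<open>simp_all add: add.commute\<close>)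
  moreover have "perp (shO D (- 1) E1) G" by (rule perp_baric[OF shift_Ble[OF E1B] G]) simp
  ultimately have "perp E0 G" using perp_extension_left[OF tri_rotate_back[OF tE]] by blast
  moreover have "perp (shO D 1 W) G"
    by (rule perp_t[OF torsion_pair_shift[OF t_pair W] Gge]) simp
  ultimately have "perp F G" by (rule perp_extension_left[OF tri_rotate[OF tF]])
  then have "F \<in> Ble (- k)"
    by (rule torsion_pair_left_if_perp[OF baric_pair t ble_in[OF Fo] G])
  then show ?thesis by (simp add: cohomology_def F_def E0_def E_def)
qed

text \<open>
  Passing from \<open>\<tau>\<^sup>\<le>\<^sup>k\<^sup>-\<^sup>1 A\<close> to \<open>\<tau>\<^sup>\<le>\<^sup>k A\<close> adds the cohomology object in degree \<open>k\<close>, which has weights at most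
  \<open>- k\<close> and so no nonzero arrow to the shifts of a cogenerator of index \<open>j \<le> k\<close>.  Below degree \<open>j\<close> the degrees
  alone exclude nonzero arrows, which starts the induction at \<open>j - 1\<close>.  Everything is shifted by \<open>k\<close>, so that
  the truncations are those in degree \<open>0\<close>, as in the definition of \<open>cohomology\<close>; quantifying over all
  truncation triangles of \<open>A[k]\<close> lets the induction hypothesis apply to one that comes from an octahedron.
\<close>

lemma truncation_perp_if_cohomology:
  assumes A: "A \<in> Ob D" and h: "\<And>k. cohomology D tle tge k A \<in> Ble (- k)"
    and B: "B \<in> Bge (1 - j)" "B \<in> Dge j" and k: "j - 1 \<le> k"
  shows "U \<in> Dle 0 \<Longrightarrow> V \<in> Dge 1 \<Longrightarrow> tri U (shO D k A) V \<Longrightarrow> perp U (shO D k B)"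
  using k
proof (induction k arbitrary: U V rule: int_ge_induct)
  case base
  have "shO D (j - 1) B \<in> Dge 1" using shift_Dge[OF Bge_objects[OF B(1)]] B(2) by simp
  then show ?case using perp_t[OF base(1)] by simp
next
  case (step i)
  have Bo: "B \<in> Ob D" by (rule Bge_objects[OF B(1)])
  define k where "k = i + 1"
  define E where "E = shO D k A"
  have E: "E \<in> Ob D" unfolding E_def by (rule shO_in[OF A])
  define E0 where "E0 = fob (tle 0) E"
  define E1 where "E1 = fob (tge 1) E"
  have E0: "E0 \<in> Dle 0" and E1: "E1 \<in> Dge 1" and tE: "tri E0 E E1"
    unfolding E0_def E1_def using tle_in[OF E, of 0] tge_in[OF E, of 0] t_tri[OF E, of 0] by simp_all
  have o: "E0 \<in> Ob D" "E1 \<in> Ob D" using tri_objects[OF tE] by blast+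
  define F where "F = fob (tge 0) E0"
  define W where "W = fob (tle (- 1)) E0"
  have F: "F \<in> Dge 0" and W: "W \<in> Dle (- 1)" and tF: "tri W E0 F"
    unfolding F_def W_def using tle_in[OF o(1), of "- 1"] tge_in[OF o(1), of "- 1"] t_tri[OF o(1), of "- 1"]
    by simp_all
  \<comment> \<open>The composite \<open>W \<rightarrow> E0 \<rightarrow> E\<close> is again a truncation, one degree lower.\<close>
  obtain V' where V': "tri W E V'" "tri F V' E1" using tri_octahedron[OF tF tE] .
  have Wo: "W \<in> Ob D" and V'o: "V' \<in> Ob D" using tri_objects[OF V'(1)] by blast+
  have "perp H V'" if "H \<in> Dle (- 1)" for H
    using perp_extension_right[OF V'(2)] perp_t[OF that F] perp_t[OF that E1] by simp
  then have "V' \<in> Dge 0" using Dge_eq[of V' "- 1"] V'o by simp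
  then have "shO D (- 1) V' \<in> Dge 1" using shift_Dge[OF V'o] by simp
  moreover have "shO D (- 1) W \<in> Dle 0" using shift_Dle[OF Wo] W by simp
  moreover have "tri (shO D (- 1) W) (shO D i A) (shO D (- 1) V')"
    using tri_shift[OF V'(1), of "- 1"] A by (simp add: E_def k_def shO_shO)
  ultimately have "perp (shO D (- 1) W) (shO D i B)" by (intro step.IH)
  then have WB: "perp W (shO D k B)"
    using perp_shift[OF Wo shO_in[OF Bo], of "- 1" i] Bo by (simp add: shO_shO k_def add.commute)
  have "F \<in> Ble (- k)" using h[of k] by (simp add: cohomology_def F_def E0_def E_def)
  then have "perp F (shO D k B)"
    by (rule perp_baric[OF _ shift_Bge[OF B(1)]]) (use step(1) in \<open>simp add: k_def\<close>)
  with WB have E0B: "perp E0 (shO D k B)" by (rule perp_extension_left[OF tF])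
  obtain f g h where T: "dist_triangle D U E V f g h"
    using step.prems by (auto simp: tri_def E_def k_def)
  have P0: "torsion_pair (Dle 0) (Dge 1)" using t_pair[of 0] by simp
  have "\<exists>u. iso_arrow D u U E0"
    unfolding E0_def
    by (rule right_adjoint_iso(2)[OF P0 _ T step.prems(1,2)])
      (use t_trunc in \<open>simp add: truncations_def\<close>)
  then obtain u where "iso_arrow D u E0 U" by (auto elim: iso_arrow_inverse)
  then show ?case using perp_iso_left[OF _ E0B] by (simp add: k_def)
qed

text \<open>
  By boundedness \<open>A\<close> is its own truncation \<open>\<tau>\<^sup>\<le>\<^sup>k A\<close> for large \<open>k\<close>.
\<close>

lemma left_orth_if_cohomology:
  assumes A: "A \<in> Ob D" and h: "\<And>k. cohomology D tle tge k A \<in> Ble (- k)"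
  shows "A \<in> left_orth"
  unfolding left_orth_def
proof (intro CollectI conjI ballI)
  show "A \<in> Ob D" by fact
  fix B assume "B \<in> cogens"
  then obtain j where B: "B \<in> Bge (1 - j)" "B \<in> Dge j" by (auto simp: cogens_def)
  obtain b where b: "A \<in> Dle b" using A t_bdd by (auto simp: t_bounded_def bounded_family_def)
  define k where "k = max b (j - 1)"
  have "A \<in> Dle k" using b Dle_mono[of b k] by (auto simp: k_def)
  then have "shO D k A \<in> Dle 0" by (simp add: shift_Dle[OF A])
  moreover obtain N where N: "zero_object D N" using zero_object_exists by blast
  ultimately have "perp (shO D k A) (shO D k B)"
    using truncation_perp_if_cohomology[OF A h B, of k "shO D k A" N] zero_object_Dge[OF N]
      tri_zero_right[OF shO_in[OF A] N] by (simp add: k_def)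
  then show "perp A B" using perp_shift_shift[OF A Bge_objects[OF B(1)]] by simp
qed

lemma staggered_le_eq: "staggered_le D tle tge Ble = left_orth"
  using left_orth_cohomology left_orth_if_cohomology
  by (auto simp: staggered_le_def left_orth_def)

text \<open>
  Shifts by \<open>1\<close> of generators are the objects of \<open>\<DD>\<^sub>\<le>\<^sub>k \<inter> \<DD>\<^sup>\<le>\<^sup>-\<^sup>k\<^sup>-\<^sup>1\<close>.  Their arrows to \<open>B\<close> factor through
  \<open>\<beta>\<^sub>\<le>\<^sub>k B\<close>, and by compatibility \<open>\<tau>\<^sup>\<le>\<^sup>-\<^sup>k\<^sup>-\<^sup>1 \<beta>\<^sub>\<le>\<^sub>k B\<close> is one of them; so they all vanish exactly when
  \<open>\<beta>\<^sub>\<le>\<^sub>k B\<close> lies in \<open>\<DD>\<^sup>\<ge>\<^sup>-\<^sup>k\<close>.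
\<close>

lemma staggered_ge_eq:
  "staggered_ge D Tge ble = {B \<in> Ob D. \<forall>A \<in> gens. perp (shO D 1 A) B}"
proof (intro equalityI subsetI)
  fix B assume "B \<in> staggered_ge D Tge ble"
  then have B: "B \<in> Ob D" "\<And>k. fob (ble k) B \<in> Dge (- k)" by (auto simp: staggered_ge_def)
  have "perp (shO D 1 A) B" if "A \<in> gens" for A
  proof -
    obtain k where A: "A \<in> Ble k" "A \<in> Dle (- k)" using \<open>A \<in> gens\<close> by (auto simp: gens_def)
    have A1: "shO D 1 A \<in> Ble k" "shO D 1 A \<in> Dle (- k - 1)"
      using shift_Ble[OF A(1)] A(2) shift_Dle[OF Ble_objects[OF A(1)]] by simp_all
    have "perp (shO D 1 A) (fob (ble k) B)" by (rule perp_t[OF A1(2) B(2)]) simp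
    moreover have "perp (shO D 1 A) (fob (bge (k + 1)) B)"
      by (rule perp_baric[OF A1(1) bge_in[OF B(1)]]) simp
    ultimately show ?thesis by (rule perp_extension_right[OF b_tri[OF B(1)]])
  qed
  then show "B \<in> {B \<in> Ob D. \<forall>A \<in> gens. perp (shO D 1 A) B}" using B(1) by blast
next
  fix B assume "B \<in> {B \<in> Ob D. \<forall>A \<in> gens. perp (shO D 1 A) B}"
  then have B: "B \<in> Ob D" "\<And>A. A \<in> gens \<Longrightarrow> perp (shO D 1 A) B" by auto
  have "fob (ble k) B \<in> Dge (- k)" for k
  proof -
    define Y where "Y = fob (ble k) B"
    have Y: "Y \<in> Ble k" unfolding Y_def by (rule ble_in[OF B(1)])
    have Yo: "Y \<in> Ob D" by (rule Ble_objects[OF Y])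
    define U where "U = fob (tle (- k - 1)) Y"
    have U: "U \<in> Dle (- k - 1)" "U \<in> Ble k" unfolding U_def by (rule tle_in[OF Yo], rule tle_Ble[OF Y])
    have Uo: "U \<in> Ob D" by (rule Ble_objects[OF U(2)])
    have "shO D (- 1) U \<in> gens"
      using gensI[OF shift_Ble[OF U(2)], of "- 1"] shift_Dle[OF Uo, of "- 1" "- k"] U(1) by simp
    then have "perp U B" using B(2) shO_inverse(1)[OF Uo, of 1] by metis
    moreover have "perp U (shO D (- 1) (fob (bge (k + 1)) B))"
      by (rule perp_baric[OF U(2) shift_Bge[OF bge_in[OF B(1)]]]) simp
    ultimately have UY: "perp U Y"
      unfolding Y_def using perp_extension_right[OF tri_rotate_back[OF b_tri[OF B(1)]]] by blast
    have "Y \<in> Dge (- k - 1 + 1)"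
      by (rule torsion_pair_right_if_perp[OF t_pair t_tri[OF Yo] tle_in[OF Yo] tge_in[OF Yo]])
        (use UY in \<open>simp add: U_def\<close>)
    then show ?thesis by (simp add: Y_def)
  qed
  then show "B \<in> staggered_ge D Tge ble" using B(1) by (auto simp: staggered_ge_def)
qed

lemma staggered_ge_1: "tpart D (staggered_ge D Tge ble) 1 = right_orth"
proof -
  have s: "staggered_ge D Tge ble \<subseteq> Ob D" by (auto simp: staggered_ge_def)
  show ?thesis
    unfolding set_eq_iff mem_tpart[OF s]
    using perp_shift_shift gens_objects by (auto simp: staggered_ge_eq right_orth_def shO_in)
qed

lemma staggered_ge_strictly_full: "strictly_full D (staggered_ge D Tge ble)"
  unfolding strictly_full_def staggered_ge_eq
  by (auto intro: perp_iso_right iso_arrow_objects(2))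

section \<open>The staggered t-structure\<close>

lemma staggered_t_structure:
  fixes \<mu> :: "'o \<Rightarrow> nat"
  assumes nondeg: "t_nondegenerate D Tle Tge"
    and \<mu>: "\<And>X n. X \<in> Dge n \<Longrightarrow> X \<notin> Dge (n + 1)
      \<Longrightarrow> \<mu> (fob (tge (n + 1)) (fob (ble (- n)) X)) < \<mu> X"
  shows "t_structure D (staggered_le D tle tge Ble) (staggered_ge D Tge ble)"
proof -
  have s: "left_orth \<subseteq> Ob D" by (auto simp: left_orth_def)
  have "left_orth \<subseteq> tpart D left_orth 1"
    using left_orth_shift s by (auto simp: mem_tpart[OF s])
  moreover have "right_orth \<subseteq> staggered_ge D Tge ble"
    using gens_shift by (auto simp: staggered_ge_eq right_orth_def)
  moreover have "Hom_vanishes D left_orth right_orth"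
    using left_orth_perp_right_orth by (simp add: Hom_vanishes_def perp_def)
  moreover have "decomposes D left_orth right_orth"
    unfolding decomposes_def tri_def[symmetric]
    using staggered_decomposition[OF nondeg \<mu>] by blast
  ultimately show ?thesis
    unfolding t_structure_def staggered_ge_1 staggered_le_eq
    using left_orth_strictly_full staggered_ge_strictly_full by blast
qed

text \<open>
  For \<open>X\<close> in \<open>\<DD>\<^sup>\<ge>\<^sup>a \<inter> \<DD>\<^sup>\<le>\<^sup>b\<close> and \<open>\<DD>\<^sub>\<ge>\<^sub>v \<inter> \<DD>\<^sub>\<le>\<^sub>w\<close>, the shift \<open>X[b + w]\<close> is a generator of index \<open>w\<close> and
  \<open>X[a + v - 1]\<close> a cogenerator of index \<open>1 - v\<close>.
\<close>

lemma staggered_bounded: "t_bounded D (staggered_le D tle tge Ble) (staggered_ge D Tge ble)"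
  unfolding t_bounded_def bounded_family_def staggered_le_eq
proof
  fix X assume X: "X \<in> Ob D"
  have s: "left_orth \<subseteq> Ob D" "staggered_ge D Tge ble \<subseteq> Ob D"
    by (auto simp: left_orth_def staggered_ge_def)
  obtain a b where ab: "X \<in> Dge a" "X \<in> Dle b"
    using t_bdd X by (auto simp: t_bounded_def bounded_family_def)
  obtain v w where vw: "X \<in> Bge v" "X \<in> Ble w" using b_bdd X by (auto simp: bounded_family_def)
  have "shO D (b + w) X \<in> gens"
    using gensI[OF shift_Ble[OF vw(2)]] shift_Dle[OF X] ab(2) by simp
  then have "shO D (b + w) X \<in> left_orth" using gens_left_orth by blast
  moreover have "shO D (a + v - 1) X \<in> cogens"
    by (rule cogensI[of _ "1 - v"]) (use shift_Bge[OF vw(1)] shift_Dge[OF X] ab(1) in simp_all)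
  then have "shO D (a + v - 1) X \<in> staggered_ge D Tge ble"
    using cogens_right_orth gens_shift unfolding staggered_ge_eq right_orth_def by blast
  ultimately show "\<exists>m n. X \<in> tpart D (staggered_ge D Tge ble) m \<inter> tpart D left_orth n"
    using X mem_tpart[OF s(1)] mem_tpart[OF s(2)] by blast
qed

end

theorem theorem2p11:
  fixes D :: "('o, 'm, 'z) tri_category_scheme"
    and Tle Tge :: "'o set"
    and tle tge :: "int \<Rightarrow> ('o, 'm, 'o, 'm) cat_functor"
    and Ble Bge :: "int \<Rightarrow> 'o set"
    and ble bge :: "int \<Rightarrow> ('o, 'm, 'o, 'm) cat_functor"
    and \<mu> :: "'o \<Rightarrow> nat"
  assumes "triangulated_category D"
    and "t_structure D Tle Tge"
    and "t_bounded D Tle Tge"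
    and "t_nondegenerate D Tle Tge"
    and "truncations D (tpart D Tle) (tpart D Tge) tle tge"
    and "baric_structure D Ble Bge"
    and "bounded_family D Ble Bge"
    and "nondegenerate_family D Ble Bge"
    and "truncations D Ble Bge ble bge"
    and "compatible D Tge tle tge Ble ble bge"
    and "\<And>X. X \<in> Ob D \<Longrightarrow> \<mu> X = 0 \<longleftrightarrow> zero_object D X"
    and "\<And>X n. X \<in> tpart D Tge n \<Longrightarrow> X \<notin> tpart D Tge (n + 1)
      \<Longrightarrow> \<mu> (fob (tge (n + 1)) (fob (ble (- n)) X)) < \<mu> X"
  shows "t_structure D (staggered_le D tle tge Ble) (staggered_ge D Tge ble)
    \<and> t_bounded D (staggered_le D tle tge Ble) (staggered_ge D Tge ble)
    \<and> t_nondegenerate D (staggered_le D tle tge Ble) (staggered_ge D Tge ble)"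
proof -
  interpret triangulated_category D by fact
  interpret compatible_structures D Tle Tge tle tge Ble Bge ble bge
    by unfold_locales fact+
  have "t_structure D (staggered_le D tle tge Ble) (staggered_ge D Tge ble)"
    by (rule staggered_t_structure[OF assms(4,12)])
  then show ?thesis using staggered_bounded t_nondegenerate_if_bounded by blast
qed

end
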